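(* For every finite group $G$, $$\mu(G)=\mathbf{cx}(G)\le \mathbf{sx}(G)\le \mathbf{chief}(G)\le \mathbf{JH}(G).$$
   Context: All groups are finite. Functions $\mathbf{c}$ go from the class of finite groups to $\mathbb{N}=\{0,1,2,\dots\}$. The complexity axioms for $\mathbf{c}$ are the following five. (Extension) If $N\lhd G$, then $\mathbf{c}(G)\le \mathbf{c}(N)+\mathbf{c}(G/N)$. (Quotient) If there is a surjective homomorphism $G\to H$, then $\mathbf{c}(G)\ge \mathbf{c}(H)$. (Constructability) Every group $G$ has a subnormal series $\mathbf{1}=G_n\lhd G_{n-1}\lhd\cdots\lhd G_0=G$ (some $n\ge 0$) with $\mathbf{c}(G_i/G_{i+1})\le 1$ for all $0\le i<n$. (Product) If $G=H\times K$, then $\mathbf{c}(G)=\max(\mathbf{c}(H),\mathbf{c}(K))$. (Initial condition) $\mathbf{c}(\mathbf{1})=0$ for the trivial group $\mathbf{1}$. A complexity function is a function satisfying these five axioms. $\mathbf{cx}$ denotes the unique maximal (pointwise largest) complexity function on finite groups, $\mathbf{cx}(G)=\sup\{\mathbf{c}(G):\mathbf{c}\text{ a complexity function}\}$. $\mu(G)$ is the shortest length $\ell$ of a subnormal series $\mathbf{1}=V_0\lhd\cdots\lhd V_\ell=G$ such that each $V_{i+1}/V_i$ is isomorphic to a direct product of finitely many simple groups. The socle $\mathrm{soc}(G)$ is the subgroup generated by the minimal normal subgroups of $G$. The socle series is $V_0=\mathbf{1}$ and $V_{i+1}$ = the preimage of $\mathrm{soc}(G/V_i)$ under the quotient map $G\to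 G/V_i$; the socle length $\mathbf{sx}(G)$ is the least $\ell\ge 0$ with $V_\ell=G$. $\mathbf{chief}(G)$ is the length of a chief series of $G$ and $\mathbf{JH}(G)$ is the number of Jordan–Hölder (composition) factors of $G$ counted with multiplicity. *)

theory Defs
  imports "HOL-Algebra.Algebra" "HOL-Library.Countable_Set" "HOL-Library.Extended_Nat"
begin

section \<open>Functions on the class of finite groups\<close>

text \<open>
  A function on the class of all finite groups is represented by a function on the groups with
  carrier in \<^typ>\<open>nat\<close>, since every finite group is isomorphic to one of these. Its value at a
  finite group over another type (a quotient or a direct product, say) is its value at a copy over
  \<^typ>\<open>nat\<close>. The axiom \<open>quotient\<close> below forces invariance under isomorphism, so the choice
  of the copy is immaterial for complexity functions (lemma \<open>class_val_iso\<close>).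
\<close>

definition nat_copy :: "('a, 'b) monoid_scheme \<Rightarrow> nat monoid" where
  "nat_copy G = image_group (to_nat_on (carrier G)) G"

definition class_val :: "(nat monoid \<Rightarrow> nat) \<Rightarrow> ('a, 'b) monoid_scheme \<Rightarrow> nat" where
  "class_val c G = c (nat_copy G)"

lemma nat_copy_iso:
  assumes "finite (carrier G)"
  shows "G \<cong> nat_copy G"
  unfolding nat_copy_def
  by (rule is_isoI, rule inj_imp_image_group_iso)
     (simp add: assms countable_finite inj_on_to_nat_on)

lemma nat_copy_group:
  assumes "group G" "finite (carrier G)"
  shows "group (nat_copy G)"
  unfolding nat_copy_def
  by (rule group.inj_imp_image_group_is_group[OF assms(1)])
     (simp add: assms countable_finite inj_on_to_nat_on)

lemma nat_copy_finite: "finite (carrier G) \<Longrightarrow> finite (carrier (nat_copy G))"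
  by (simp add: nat_copy_def image_group_def)


section \<open>Normal series\<close>

text \<open>The chain of subgroups is indexed from the bottom, \<open>V 0 = {\<one>}\<close>, to the top.\<close>

definition subnormal_series ::
  "('a, 'b) monoid_scheme \<Rightarrow> nat \<Rightarrow> (nat \<Rightarrow> 'a set) \<Rightarrow> bool" where
  "subnormal_series G n V \<longleftrightarrow>
     V 0 = {\<one>\<^bsub>G\<^esub>} \<and> V n = carrier G \<and> (\<forall>i<n. V i \<lhd> G\<lparr>carrier := V (Suc i)\<rparr>)"

definition series_factor :: "('a, 'b) monoid_scheme \<Rightarrow> (nat \<Rightarrow> 'a set) \<Rightarrow> nat \<Rightarrow> 'a set monoid" where
  "series_factor G V i = G\<lparr>carrier := V (Suc i)\<rparr> Mod V i"

definition composition_series ::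
  "('a, 'b) monoid_scheme \<Rightarrow> nat \<Rightarrow> (nat \<Rightarrow> 'a set) \<Rightarrow> bool" where
  "composition_series G n V \<longleftrightarrow>
     subnormal_series G n V \<and> (\<forall>i<n. simple_group (series_factor G V i))"

definition chief_series ::
  "('a, 'b) monoid_scheme \<Rightarrow> nat \<Rightarrow> (nat \<Rightarrow> 'a set) \<Rightarrow> bool" where
  "chief_series G n V \<longleftrightarrow>
     V 0 = {\<one>\<^bsub>G\<^esub>} \<and> V n = carrier G \<and> (\<forall>i\<le>n. V i \<lhd> G) \<and>
     (\<forall>i<n. V i \<subset> V (Suc i) \<and>
        (\<forall>M. M \<lhd> G \<and> V i \<subseteq> M \<and> M \<subseteq> V (Suc i) \<longrightarrow> M = V i \<or> M = V (Suc i)))"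

text \<open>
  By the Jordan--Hoelder theorem the lengths below do not depend on the chosen series.
\<close>

definition chief_length :: "('a, 'b) monoid_scheme \<Rightarrow> nat" where
  "chief_length G = (SOME n. \<exists>V. chief_series G n V)"

definition JH_length :: "('a, 'b) monoid_scheme \<Rightarrow> nat" where
  "JH_length G = (SOME n. \<exists>V. composition_series G n V)"

text \<open>
  If the product is a finite group, then so are its factors, hence it is no restriction to take
  the factors over \<^typ>\<open>nat\<close>.
\<close>

definition product_of_simples :: "('a, 'b) monoid_scheme \<Rightarrow> bool" where
  "product_of_simples G \<longleftrightarrow>
     (\<exists>(k::nat) (S :: nat \<Rightarrow> nat monoid).
        (\<forall>j<k. simple_group (S j)) \<and> G \<cong> product_group {..<k} S)"

definition mu :: "('a, 'b) monoid_scheme \<Rightarrow> nat" where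
  "mu G = (LEAST l. \<exists>V. subnormal_series G l V \<and>
                         (\<forall>i<l. product_of_simples (series_factor G V i)))"


section \<open>Socle length\<close>

definition minimal_normal :: "'a set \<Rightarrow> ('a, 'b) monoid_scheme \<Rightarrow> bool" where
  "minimal_normal N G \<longleftrightarrow>
     N \<lhd> G \<and> N \<noteq> {\<one>\<^bsub>G\<^esub>} \<and> (\<forall>M. M \<lhd> G \<and> M \<subseteq> N \<longrightarrow> M = {\<one>\<^bsub>G\<^esub>} \<or> M = N)"

definition socle :: "('a, 'b) monoid_scheme \<Rightarrow> 'a set" where
  "socle G = generate G (\<Union>{N. minimal_normal N G})"

primrec socle_series :: "('a, 'b) monoid_scheme \<Rightarrow> nat \<Rightarrow> 'a set" where
  "socle_series G 0 = {\<one>\<^bsub>G\<^esub>}"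
| "socle_series G (Suc i) =
     {x \<in> carrier G. socle_series G i #>\<^bsub>G\<^esub> x \<in> socle (G Mod socle_series G i)}"

definition socle_length :: "('a, 'b) monoid_scheme \<Rightarrow> nat" where
  "socle_length G = (LEAST l. socle_series G l = carrier G)"


section \<open>Complexity functions\<close>

locale complexity_function =
  fixes c :: "nat monoid \<Rightarrow> nat"
  assumes extension:
      "\<And>(G :: nat monoid) N. \<lbrakk>group G; finite (carrier G); N \<lhd> G\<rbrakk>
         \<Longrightarrow> c G \<le> c (G\<lparr>carrier := N\<rparr>) + class_val c (G Mod N)"
    and quotient:
      "\<And>(G :: nat monoid) (H :: nat monoid) f. \<lbrakk>group G; finite (carrier G); group H; finite (carrier H); f \<in> epi G H\<rbrakk>
         \<Longrightarrow> c H \<le> c G"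
    and constructability:
      "\<And>G :: nat monoid. \<lbrakk>group G; finite (carrier G)\<rbrakk>
         \<Longrightarrow> \<exists>n V. subnormal_series G n V \<and> (\<forall>i<n. class_val c (series_factor G V i) \<le> 1)"
    and product:
      "\<And>(H :: nat monoid) (K :: nat monoid). \<lbrakk>group H; finite (carrier H); group K; finite (carrier K)\<rbrakk>
         \<Longrightarrow> class_val c (H \<times>\<times> K) = max (c H) (c K)"
    and initial:
      "\<And>G :: nat monoid. \<lbrakk>group G; carrier G = {\<one>\<^bsub>G\<^esub>}\<rbrakk> \<Longrightarrow> c G = 0"
begin

lemma iso_invariant:
  assumes "group G" "finite (carrier G)" "group H" "finite (carrier H)" "G \<cong> H"
  shows "c G = c H"
proof -
  have "H \<cong> G"
    using assms by (simp add: group.iso_sym)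
  with assms show ?thesis
    by (metis is_iso_def ex_in_conv iso_iff_mon_epi le_antisym quotient)
qed

lemma class_val_iso:
  fixes G :: "('a, 'b) monoid_scheme"
  assumes "group G" "finite (carrier G)" "group H" "finite (carrier H)" "G \<cong> H"
  shows "class_val c G = c H"
proof -
  have "nat_copy G \<cong> H"
    using assms by (meson group.iso_sym iso_trans nat_copy_iso)
  then show ?thesis
    unfolding class_val_def using assms
    by (intro iso_invariant) (auto simp: nat_copy_group nat_copy_finite)
qed

end

text \<open>
  The supremum is taken in \<^typ>\<open>enat\<close>, where it has its usual meaning without knowing
  beforehand that it is finite.
\<close>

definition cx :: "('a, 'b) monoid_scheme \<Rightarrow> enat" where
  "cx G = Sup {enat (class_val c G) | c. complexity_function c}"

end

theory Submission
  imports Defs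
begin

text \<open>
  Every complexity function is at most 1 on simple groups, because a subnormal series of a simple
  group \<open>S\<close> has a factor isomorphic to \<open>S\<close>; by the product axiom it is then at most 1 on
  products of simple groups, and by the extension axiom at most \<open>mu\<close>. Conversely \<open>mu\<close>
  itself is a complexity function, because products of simple groups are closed under direct
  products and quotients. Hence \<open>mu = cx\<close>.

  The socle is generated by minimal normal subgroups, each of which is a product of simple groups
  (adjoin the conjugates of a minimal normal subgroup of it one at a time), so the socle series is
  one of the series competing in the definition of \<open>mu\<close>. The \<open>i\<close>-th term of a chief series
  lies in the \<open>i\<close>-th term of the socle series. Finally, intersecting a chain of normal subgroups with the last
  proper term \<open>N\<close> of a composition series identifies at most one pair of members, since \<open>N\<close>
  is a maximal normal subgroup, so such a chain is no longer than the composition series.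
\<close>

section \<open>Factor groups and simple groups\<close>

text \<open>The composite of \<open>f\<close> with the quotient map of \<open>B\<close> kills
  \<open>N\<close>, hence factors through \<open>A Mod N\<close>, and the factor map inherits
  surjectivity. It carries the top factor of a series over to a homomorphic image.\<close>

lemma mod_epi:
  assumes "group A" "group B" "N \<lhd> A" "M \<lhd> B" "f \<in> epi A B" "f ` N \<subseteq> M"
  obtains g where "g \<in> epi (A Mod N) (B Mod M)"
proof -
  have f: "f \<in> hom A B" "f ` carrier A = carrier B" using assms(5) by (auto simp: epi_def)
  interpret M: normal M B by fact
  interpret N: normal N A by fact
  have h: "(\<lambda>x. M #>\<^bsub>B\<^esub> f x) \<in> hom A (B Mod M)"
    using hom_compose[OF f(1) M.r_coset_hom_Mod] by (simp add: o_def)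
  interpret h: group_hom A "B Mod M" "\<lambda>x. M #>\<^bsub>B\<^esub> f x"
    using h assms M.factorgroup_is_group by (simp add: group_hom_def group_hom_axioms_def)
  have "N \<subseteq> kernel A (B Mod M) (\<lambda>x. M #>\<^bsub>B\<^esub> f x)"
    using assms(6) N.subset by (auto simp: kernel_def M.rcos_const image_subset_iff subset_iff)
  then obtain g where g: "g \<in> hom (A Mod N) (B Mod M)"
      "\<And>x. x \<in> carrier A \<Longrightarrow> g (N #>\<^bsub>A\<^esub> x) = M #>\<^bsub>B\<^esub> f x"
    using h.FactGroup_universal_kernel[OF assms(3)] by metis
  have "carrier (B Mod M) \<subseteq> g ` carrier (A Mod N)"
  proof
    fix y assume "y \<in> carrier (B Mod M)"
    then obtain b where b: "b \<in> carrier B" "y = M #>\<^bsub>B\<^esub> b" by (auto simp: carrier_FactGroup)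
    then obtain a where "a \<in> carrier A" "b = f a" using f(2) by auto
    then show "y \<in> g ` carrier (A Mod N)" using g(2) b by (auto simp: carrier_FactGroup)
  qed
  then have "g \<in> epi (A Mod N) (B Mod M)" using g(1) by (simp add: epi_iff_subset)
  then show thesis by (rule that)
qed

text \<open>The preimage \<open>N\<close> is the kernel of the composite of \<open>f\<close> with
  the quotient map of \<open>B\<close>, so both claims come from the first isomorphism theorem. This
  is how normal subgroups of a quotient are pulled back later on.\<close>

lemma mod_preimage:
  assumes "group A" "group B" "M \<lhd> B" "f \<in> epi A B" "N = {x \<in> carrier A. f x \<in> M}"
  shows "N \<lhd> A" and "A Mod N \<cong> B Mod M"
proof -
  have f: "f \<in> hom A B" "f ` carrier A = carrier B" using assms(4) by (auto simp: epi_def)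
  interpret M: normal M B by fact
  interpret h: group_hom A "B Mod M" "\<lambda>x. M #>\<^bsub>B\<^esub> f x"
    using hom_compose[OF f(1) M.r_coset_hom_Mod] assms M.factorgroup_is_group
    by (simp add: group_hom_def group_hom_axioms_def o_def)
  have k: "kernel A (B Mod M) (\<lambda>x. M #>\<^bsub>B\<^esub> f x) = N"
    using f M.rcos_const M.rcos_self M.coset_join1[OF _ _ M.subgroup_axioms] M.subset assms(5)
    by (auto simp: kernel_def hom_def Pi_iff)
  show "N \<lhd> A" using h.normal_kernel k by simp
  have "(\<lambda>x. M #>\<^bsub>B\<^esub> f x) ` carrier A = carrier (B Mod M)"
    using f(2) by (simp add: carrier_FactGroup image_image[symmetric])
  from h.FactGroup_iso[OF this] show "A Mod N \<cong> B Mod M" using k by simp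
qed

lemma iso_obtain_epi:
  assumes "A \<cong> B" obtains f where "f \<in> epi A B"
  using assms by (auto simp: is_iso_def iso_iff_mon_epi)

lemma simple_group_finite: "simple_group G \<Longrightarrow> finite (carrier G)"
  using simple_group.order_gt_one[of G] monoid.order_gt_0_iff_finite[of G]
  by (simp add: simple_group_def group_def)

lemma simple_groupI:
  assumes "group G" "finite (carrier G)" "carrier G \<noteq> {\<one>\<^bsub>G\<^esub>}"
    and "\<And>H. H \<lhd> G \<Longrightarrow> H = carrier G \<or> H = {\<one>\<^bsub>G\<^esub>}"
  shows "simple_group G"
proof -
  have "order G > 0" using assms by (simp add: group.is_monoid monoid.order_gt_0_iff_finite)
  moreover have "order G \<noteq> 1" using assms(1,3) group.order_one_triv_iff by blast
  ultimately show ?thesis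
    using assms by (simp add: simple_group_def simple_group_axioms_def)
qed

text \<open>A normal subgroup of \<open>T\<close> is the image of its preimage in \<open>S\<close>,
  and simplicity of \<open>S\<close> leaves only two candidates for that preimage.\<close>

lemma epi_simple_group:
  assumes S: "simple_group S" and T: "group T" and g: "g \<in> epi S T"
  shows "simple_group T \<or> carrier T = {\<one>\<^bsub>T\<^esub>}"
proof -
  interpret S: simple_group S by fact
  have *: "H = carrier T \<or> H = {\<one>\<^bsub>T\<^esub>}" if H: "H \<lhd> T" for H
  proof -
    interpret H: normal H T by fact
    have sub: "H \<subseteq> g ` carrier S" using H.subset g by (auto simp: epi_def)
    have "{x \<in> carrier S. g x \<in> H} \<lhd> S"
      using mod_preimage(1)[OF S.is_group T H g] by simp
    then consider "{x \<in> carrier S. g x \<in> H} = carrier S" | "{x \<in> carrier S. g x \<in> H} = {\<one>\<^bsub>S\<^esub>}"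
      using S.no_real_normal_subgroup by blast
    then show ?thesis
    proof cases
      case 1
      then have "g ` carrier S \<subseteq> H" by blast
      then show ?thesis using H.subset g by (auto simp: epi_def)
    next
      case 2
      have "g \<one>\<^bsub>S\<^esub> = \<one>\<^bsub>T\<^esub>" using g S.is_group T by (auto simp: epi_def hom_one)
      then have "h = \<one>\<^bsub>T\<^esub>" if "h \<in> H" for h using that sub 2 by (smt (verit) imageE mem_Collect_eq singletonD subsetD)
      then show ?thesis using H.one_closed by auto
    qed
  qed
  have "finite (carrier T)"
    using finite_imageI[OF simple_group_finite[OF S], of g] g by (simp add: epi_def)
  then show ?thesis using simple_groupI[OF T _ _ *] by metis
qed

lemma nat_copy_simple:
  assumes "simple_group G" shows "simple_group (nat_copy G)"
proof -
  note fin = simple_group_finite[OF assms]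
  have G: "group G" using assms by (simp add: simple_group_def)
  obtain f where "f \<in> iso G (nat_copy G)" using nat_copy_iso[OF fin] by (auto simp: is_iso_def)
  then show ?thesis using simple_group.iso_simple[OF assms nat_copy_group[OF G fin]] by blast
qed

section \<open>Adjoining a simple factor to a product of simple groups\<close>

lemma product_of_simples_iso:
  assumes "product_of_simples A" "group A" "A \<cong> B"
  shows "product_of_simples B"
proof -
  have "B \<cong> A" using assms group.iso_sym by blast
  then show ?thesis using assms(1) unfolding product_of_simples_def by (meson iso_trans)
qed

lemma product_group_Suc_iso:
  assumes "\<And>j. j < Suc k \<Longrightarrow> group (S j)"
  shows "(\<lambda>(x, y). x(k := y)) \<in> iso (product_group {..<k} S \<times>\<times> S k) (product_group {..<Suc k} S)"
    (is "?f \<in> iso ?A ?B")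
proof (rule isoI)
  have closed: "?f x \<in> carrier ?B" if "x \<in> carrier ?A" for x
    using that by (auto simp: PiE_def Pi_def extensional_def less_Suc_eq)
  show "?f \<in> hom ?A ?B"
  proof (rule homI)
    fix x assume "x \<in> carrier ?A"
    then show "?f x \<in> carrier ?B" by (rule closed)
  next
    fix x y assume "x \<in> carrier ?A" "y \<in> carrier ?A"
    then show "?f (x \<otimes>\<^bsub>?A\<^esub> y) = ?f x \<otimes>\<^bsub>?B\<^esub> ?f y"
      by (intro ext) (simp add: mult_DirProd' restrict_def less_Suc_eq split_beta)
  qed
  show "bij_betw ?f (carrier ?A) (carrier ?B)"
  \<comment> \<open>Elements of a product group are extensional functions, so the inverse map must
    reset the removed coordinate \<open>k\<close> to \<open>undefined\<close>.\<close>
  proof (rule bij_betw_byWitness[where f' = "\<lambda>z. (z(k := undefined), z k)"])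
    show "?f ` carrier ?A \<subseteq> carrier ?B" using closed by blast
    show "(\<lambda>z. (z(k := undefined), z k)) ` carrier ?B \<subseteq> carrier ?A"
      by (auto simp: PiE_def Pi_def extensional_def)
  qed (auto simp: PiE_def extensional_def fun_eq_iff)
qed

lemma finite_product_group_lessThan:
  fixes k :: nat
  assumes "\<And>j. j < k \<Longrightarrow> finite (carrier (S j))"
  shows "finite (carrier (product_group {..<k} S))"
  using assms by (auto intro!: finite_PiE)

lemma product_of_simples_trivial:
  assumes "group G" "carrier G = {\<one>\<^bsub>G\<^esub>}" shows "product_of_simples G"
proof -
  \<comment> \<open>The trivial group is the empty product, whose only element is the function that
    is \<open>undefined\<close> everywhere.\<close>
  let ?P = "product_group {..<0::nat} (\<lambda>_. undefined :: nat monoid)"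
  have "(\<lambda>_. \<lambda>_. undefined) \<in> iso G ?P"
    using assms by (auto simp: iso_def hom_def bij_betw_def)
  then have "G \<cong> ?P" by (rule is_isoI)
  then show ?thesis unfolding product_of_simples_def by (metis less_nat_zero_code)
qed

lemma product_of_simples_DirProd_simple:
  assumes "product_of_simples A" "group A" "simple_group T"
  shows "product_of_simples (A \<times>\<times> T)"
proof -
  obtain k :: nat and S :: "nat \<Rightarrow> nat monoid"
    where S: "\<And>j. j < k \<Longrightarrow> simple_group (S j)" "A \<cong> product_group {..<k} S"
    using assms(1) unfolding product_of_simples_def by blast
  \<comment> \<open>The simple group \<open>T\<close> may live over any type, while the factors in
    \<open>product_of_simples\<close> live over \<open>nat\<close>. Hence its copy is inserted at
    the free index \<open>k\<close>, which does not affect the product over the indices below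
    \<open>k\<close>.\<close>
  define S' where "S' = S(k := nat_copy T)"
  have T: "T \<cong> nat_copy T" using assms(3) simple_group_finite nat_copy_iso by blast
  have eq: "product_group {..<k} S = product_group {..<k} S'"
    by (auto simp: product_group_def S'_def fun_eq_iff intro!: PiE_cong cong: restrict_cong)
  have s: "simple_group (S' j)" if "j < Suc k" for j
    using that S nat_copy_simple[OF assms(3)] by (auto simp: S'_def less_Suc_eq)
  have "A \<times>\<times> T \<cong> product_group {..<k} S' \<times>\<times> S' k"
    using group.DirProd_iso_trans[OF assms(2) S(2) T] eq by (simp add: S'_def)
  also have "\<dots> \<cong> product_group {..<Suc k} S'"
    by (rule is_isoI, rule product_group_Suc_iso) (use s in \<open>auto simp: simple_group_def\<close>)
  finally show ?thesis using s unfolding product_of_simples_def by blast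
qed

section \<open>Products of simple groups\<close>

lemma (in group) normal_set_mult:
  assumes "A \<lhd> G" "B \<lhd> G"
  shows "A <#> B \<lhd> G"
proof (rule normal_invI)
  interpret A: normal A G by fact
  interpret B: normal B G by fact
  interpret AB: second_isomorphism_grp A G B
    by unfold_locales
  show "subgroup (A <#> B) G" by (rule AB.normal_set_mult_subgroup)
  fix x h assume x: "x \<in> carrier G" and "h \<in> A <#> B"
  then obtain a b where ab: "a \<in> A" "b \<in> B" "h = a \<otimes> b" by (auto simp: set_mult_def)
  then have c: "a \<in> carrier G" "b \<in> carrier G" using A.subset B.subset by auto
  have "x \<otimes> h \<otimes> inv x = (x \<otimes> a \<otimes> inv x) \<otimes> (x \<otimes> b \<otimes> inv x)"
    using x c ab(3) by (simp add: m_assoc inv_solve_left)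
  then show "x \<otimes> h \<otimes> inv x \<in> A <#> B"
    using A.inv_op_closed2[OF x ab(1)] B.inv_op_closed2[OF x ab(2)] by (auto simp: set_mult_def)
qed

lemma (in group) set_mult_normal_upper:
  assumes "A \<lhd> G" "B \<lhd> G"
  shows "A \<subseteq> A <#> B" "B \<subseteq> A <#> B"
proof -
  interpret A: normal A G by fact
  interpret B: normal B G by fact
  interpret AB: second_isomorphism_grp A G B
    by unfold_locales
  show "A \<subseteq> A <#> B" "B \<subseteq> A <#> B"
    by (rule AB.H_contained_in_set_mult, rule AB.S_contained_in_set_mult)
qed

lemma (in group) set_mult_least:
  assumes "A \<subseteq> C" "B \<subseteq> C" "subgroup C G"
  shows "A <#> B \<subseteq> C"
  using assms subgroup.m_closed[of C G] by (fastforce simp: set_mult_def)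

lemma product_of_simples_DirProd_product_group:
  assumes "product_of_simples A" "group A" "\<And>j. j < k \<Longrightarrow> simple_group (S j)"
  shows "product_of_simples (A \<times>\<times> product_group {..<k::nat} S)"
  using assms(3)
proof (induction k)
  case 0
  let ?P = "product_group {..<0::nat} S"
  have "(\<lambda>a. (a, \<lambda>_. undefined)) \<in> iso A (A \<times>\<times> ?P)"
    by (auto simp: iso_def hom_def bij_betw_def inj_on_def)
  then show ?case using product_of_simples_iso[OF assms(1,2)] is_isoI by blast
next
  case (Suc k)
  let ?P = "product_group {..<k} S"
  have S: "simple_group (S j)" "group (S j)" if "j \<le> k" for j
    using Suc.prems that by (auto simp: simple_group_def)
  have P1: "group ?P" using S by (intro product_group) auto
  then have P: "group ?P" "group (A \<times>\<times> ?P)" "group ((A \<times>\<times> ?P) \<times>\<times> S k)"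
    using S by (auto intro!: DirProd_group assms(2))
  \<comment> \<open>Reassociating the triple product reduces the step to adjoining the single simple
    factor \<open>S k\<close>.\<close>
  have "(\<lambda>((x, y), z). (x, y, z)) \<in> iso ((A \<times>\<times> ?P) \<times>\<times> S k) (A \<times>\<times> (?P \<times>\<times> S k))"
    by (auto simp: iso_def hom_def bij_betw_def inj_on_def image_def)
  then have "((A \<times>\<times> ?P) \<times>\<times> S k) \<cong> (A \<times>\<times> (?P \<times>\<times> S k))" by (rule is_isoI)
  also have "\<dots> \<cong> A \<times>\<times> product_group {..<Suc k} S"
    by (rule group.DirProd_iso_trans[OF assms(2) iso_refl is_isoI[OF product_group_Suc_iso]])
      (use S in auto)
  finally have "((A \<times>\<times> ?P) \<times>\<times> S k) \<cong> A \<times>\<times> product_group {..<Suc k} S" .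
  moreover have "product_of_simples ((A \<times>\<times> ?P) \<times>\<times> S k)"
    using product_of_simples_DirProd_simple[OF _ P(2) S(1)] Suc by simp
  ultimately show ?case using product_of_simples_iso P(3) by blast
qed

lemma product_of_simples_DirProd:
  assumes "product_of_simples A" "group A" "product_of_simples B" "group B"
  shows "product_of_simples (A \<times>\<times> B)"
proof -
  obtain k :: nat and S :: "nat \<Rightarrow> nat monoid"
    where S: "\<And>j. j < k \<Longrightarrow> simple_group (S j)" "B \<cong> product_group {..<k} S"
    using assms(3) unfolding product_of_simples_def by blast
  let ?P = "product_group {..<k} S"
  have P: "group ?P" using S(1) by (intro product_group) (auto simp: simple_group_def)
  have "?P \<cong> B" using S(2) assms(4) group.iso_sym by blast
  then have "A \<times>\<times> ?P \<cong> A \<times>\<times> B"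
    by (intro group.DirProd_iso_trans[OF assms(2)] iso_refl)
  moreover have "product_of_simples (A \<times>\<times> ?P)"
    using product_of_simples_DirProd_product_group[OF assms(1,2)] S(1) by blast
  ultimately show ?thesis using product_of_simples_iso DirProd_group[OF assms(2) P] by blast
qed

lemma simple_imp_product_of_simples:
  assumes "simple_group G" shows "product_of_simples G"
proof -
  \<comment> \<open>Adjoining \<open>G\<close> to the empty product gives a trivial group times
    \<open>G\<close>, and the second projection identifies this with \<open>G\<close>.\<close>
  let ?T = "singleton_group (0::nat)"
  have "product_of_simples ?T"
    by (rule product_of_simples_trivial[OF singleton_group]) (simp add: singleton_group_def)
  then have "product_of_simples (?T \<times>\<times> G)"
    using assms by (intro product_of_simples_DirProd_simple) auto
  moreover have "snd \<in> iso (?T \<times>\<times> G) G"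
    by (auto simp: iso_def hom_def bij_betw_def inj_on_def image_def mult_DirProd')
  moreover have "group (?T \<times>\<times> G)" using assms by (auto intro!: DirProd_group simp: simple_group_def)
  ultimately show ?thesis using product_of_simples_iso is_isoI by blast
qed

text \<open>Normal subgroups with trivial intersection commute elementwise, so multiplication is an
  isomorphism from the external product of \<open>A\<close> and \<open>B\<close> onto
  \<open>A <#> B\<close>.\<close>

lemma (in group) product_of_simples_set_mult:
  assumes "A \<lhd> G" "B \<lhd> G" "A \<inter> B = {\<one>}"
    and "product_of_simples (G\<lparr>carrier := A\<rparr>)" "product_of_simples (G\<lparr>carrier := B\<rparr>)"
  shows "product_of_simples (G\<lparr>carrier := A <#> B\<rparr>)"
proof -
  interpret A: normal A G by fact
  interpret B: normal B G by fact
  let ?P = "G\<lparr>carrier := A\<rparr> \<times>\<times> G\<lparr>carrier := B\<rparr>"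
  have gr: "group (G\<lparr>carrier := A\<rparr>)" "group (G\<lparr>carrier := B\<rparr>)"
    using A.subgroup_axioms B.subgroup_axioms subgroup_imp_group by auto
  let ?f = "\<lambda>(x, y). x \<otimes> y"
  have comm: "x \<otimes> y = y \<otimes> x" if "x \<in> A" "y \<in> B" for x y
    using normal_imp_commuting[OF assms(1,2)] assms(3) that by blast
  have inj: "x = x' \<and> y = y'" if h: "x \<in> A" "x' \<in> A" "y \<in> B" "y' \<in> B" "x \<otimes> y = x' \<otimes> y'" for x x' y y'
  proof -
    have c: "x \<in> carrier G" "x' \<in> carrier G" "y \<in> carrier G" "y' \<in> carrier G"
      using h A.subset B.subset by auto
    \<comment> \<open>The left side lies in \<open>A\<close> and the right side in \<open>B\<close>,
      so both are trivial; this is injectivity of the multiplication map.\<close>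
    have e: "inv x' \<otimes> x = y' \<otimes> inv y"
      using c h(5) by (metis inv_closed inv_solve_left inv_solve_right m_assoc m_closed)
    have "inv x' \<otimes> x \<in> A" using h by simp
    moreover have "inv x' \<otimes> x \<in> B" unfolding e using h by simp
    ultimately have "inv x' \<otimes> x = \<one>" using assms(3) by blast
    moreover from this have "y' \<otimes> inv y = \<one>" using e by simp
    ultimately show ?thesis using c by (metis inv_equality inv_inv inv_closed)
  qed
  have "?f \<in> iso ?P (G\<lparr>carrier := A <#> B\<rparr>)"
  proof (rule isoI)
    show "?f \<in> hom ?P (G\<lparr>carrier := A <#> B\<rparr>)"
    proof (rule homI)
      fix u v assume "u \<in> carrier ?P" "v \<in> carrier ?P"
      then obtain a b c d where abcd: "u = (a, b)" "v = (c, d)" "a \<in> A" "b \<in> B" "c \<in> A" "d \<in> B" by auto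
      then have "a \<in> carrier G" "b \<in> carrier G" "c \<in> carrier G" "d \<in> carrier G"
        using A.subset B.subset by auto
      then have "(a \<otimes> c) \<otimes> (b \<otimes> d) = (a \<otimes> b) \<otimes> (c \<otimes> d)"
        using comm[OF abcd(5,4)] by (metis m_assoc m_closed)
      then show "?f (u \<otimes>\<^bsub>?P\<^esub> v) = ?f u \<otimes>\<^bsub>G\<lparr>carrier := A <#> B\<rparr>\<^esub> ?f v"
        using abcd by simp
    qed (auto simp: set_mult_def)
    show "bij_betw ?f (carrier ?P) (carrier (G\<lparr>carrier := A <#> B\<rparr>))"
      unfolding bij_betw_def
    proof
      show "inj_on ?f (carrier ?P)" using inj by (auto simp: inj_on_def)
    qed (auto simp: set_mult_def)
  qed
  then show ?thesis
    using product_of_simples_iso[OF product_of_simples_DirProd[OF assms(4) gr(1) assms(5) gr(2)]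
        DirProd_group[OF gr] is_isoI] by blast
qed

text \<open>By minimality \<open>B\<close> either meets \<open>A\<close> trivially, and the join is
  a direct product, or lies inside \<open>A\<close>, and the join is \<open>A\<close>
  itself.\<close>

lemma (in group) product_of_simples_join:
  assumes "A \<lhd> G" "minimal_normal B G"
    and "product_of_simples (G\<lparr>carrier := A\<rparr>)" "product_of_simples (G\<lparr>carrier := B\<rparr>)"
  shows "product_of_simples (G\<lparr>carrier := A <#> B\<rparr>)"
proof -
  have B: "B \<lhd> G" using assms(2) by (simp add: minimal_normal_def)
  have "A \<inter> B \<lhd> G" by (rule normal_subgroup_intersect[OF assms(1) B])
  then consider "A \<inter> B = {\<one>}" | "A \<inter> B = B"
    using assms(2) unfolding minimal_normal_def by blast
  then show ?thesis
  proof cases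
    case 1
    then show ?thesis using product_of_simples_set_mult assms B by blast
  next
    case 2
    then have "A <#> B = A"
      using set_mult_least[of A A B] set_mult_normal_upper[OF assms(1) B]
        normal_imp_subgroup[OF assms(1)] by blast
    then show ?thesis using assms(3) by simp
  qed
qed

section \<open>Quotients and socles of products of simple groups\<close>

lemma normal_imp_subset: "N \<lhd> G \<Longrightarrow> N \<subseteq> carrier G"
  by (simp add: normal_imp_subgroup subgroup.subset)

lemma (in group) carrier_normal: "carrier G \<lhd> G"
  by (simp add: normal_inv_iff subgroup_self)

lemma (in group) finite_normals:
  assumes "finite (carrier G)" shows "finite {N. N \<lhd> G}"
proof (rule finite_subset)
  show "{N. N \<lhd> G} \<subseteq> Pow (carrier G)"
    using normal_imp_subset by blast
qed (use assms in simp)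

lemma (in group) minimal_normal_exists:
  assumes "finite (carrier G)" "carrier G \<noteq> {\<one>}"
  shows "\<exists>N. minimal_normal N G"
proof -
  let ?X = "{N. N \<lhd> G \<and> N \<noteq> {\<one>}}"
  have "finite ?X" by (rule finite_subset[OF _ finite_normals[OF assms(1)]]) auto
  moreover have "?X \<noteq> {}" using carrier_normal assms(2) by blast
  ultimately obtain N where "N \<in> ?X" "\<forall>M\<in>?X. M \<subseteq> N \<longrightarrow> N = M"
    using finite_has_minimal by meson
  then show ?thesis unfolding minimal_normal_def by blast
qed

text \<open>A normal subgroup of \<open>G\<close> contained in \<open>T\<close> is also normal in
  \<open>T\<close>. This makes \<open>product_of_simples_join\<close> applicable to a simple normal
  subgroup.\<close>

lemma (in group) simple_normal_imp_minimal_normal: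
  assumes "T \<lhd> G" "simple_group (G\<lparr>carrier := T\<rparr>)"
  shows "minimal_normal T G"
proof -
  have "M = {\<one>} \<or> M = T" if "M \<lhd> G" "M \<subseteq> T" for M
    using simple_group.no_real_normal_subgroup[OF assms(2), of M]
      normal_restrict_supergroup[OF normal_imp_subgroup[OF assms(1)] that] by auto
  moreover have "T \<noteq> {\<one>}" using simple_group.simple_not_triv[OF assms(2)] by simp
  ultimately show ?thesis using assms(1) by (simp add: minimal_normal_def)
qed

lemma epi_restrict:
  assumes "group G" "group H" "f \<in> hom G H" "subgroup S G"
  shows "f \<in> epi (G\<lparr>carrier := S\<rparr>) (H\<lparr>carrier := f ` S\<rparr>)" "subgroup (f ` S) H"
proof -
  interpret group_hom G H f using assms by (simp add: group_hom_def group_hom_axioms_def)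
  show "subgroup (f ` S) H" using assms(4) by (rule subgroup_img_is_subgroup)
  show "f \<in> epi (G\<lparr>carrier := S\<rparr>) (H\<lparr>carrier := f ` S\<rparr>)"
    using subgroup.subset[OF assms(4)] hom_mult by (auto simp: epi_def hom_def subset_iff)
qed

lemma normal_image_epi:
  assumes "group G" "group H" "f \<in> epi G H" "N \<lhd> G"
  shows "f ` N \<lhd> H"
  using normal.surj_hom_normal_subgroup[OF assms(4)] assms
  by (auto simp: group_hom_def group_hom_axioms_def epi_def)

lemma DirProd_epi_factors:
  assumes "group P" "group K"
  shows "(\<lambda>x. (x, \<one>\<^bsub>K\<^esub>)) \<in> epi P ((P \<times>\<times> K)\<lparr>carrier := carrier P \<times> {\<one>\<^bsub>K\<^esub>}\<rparr>)"
    and "(\<lambda>x. (\<one>\<^bsub>P\<^esub>, x)) \<in> epi K ((P \<times>\<times> K)\<lparr>carrier := {\<one>\<^bsub>P\<^esub>} \<times> carrier K\<rparr>)"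
proof -
  interpret P: group P by fact
  interpret K: group K by fact
  show "(\<lambda>x. (x, \<one>\<^bsub>K\<^esub>)) \<in> epi P ((P \<times>\<times> K)\<lparr>carrier := carrier P \<times> {\<one>\<^bsub>K\<^esub>}\<rparr>)"
    "(\<lambda>x. (\<one>\<^bsub>P\<^esub>, x)) \<in> epi K ((P \<times>\<times> K)\<lparr>carrier := {\<one>\<^bsub>P\<^esub>} \<times> carrier K\<rparr>)"
    by (auto simp: epi_def hom_def)
qed

text \<open>Induction on the number of factors. The image of the first \<open>k\<close> factors is a
  product of simple groups by induction, and the image of the last factor is simple or trivial. Both
  images are normal and together they give \<open>B\<close>, so the last one is either joined as a
  minimal normal subgroup or disappears.\<close>

lemma product_of_simples_epi_product_group:
  assumes "\<And>j. j < k \<Longrightarrow> simple_group (S j)" "f \<in> epi (product_group {..<k::nat} S) B" "group B"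
  shows "product_of_simples B"
  using assms
proof (induction k arbitrary: f B)
  case 0
  then have "carrier B = {f (\<lambda>_. undefined)}" by (auto simp: epi_def)
  then have "carrier B = {\<one>\<^bsub>B\<^esub>}" using monoid.one_closed[OF group.is_monoid[OF 0(3)]] by auto
  then show ?case using product_of_simples_trivial 0 by blast
next
  case (Suc k)
  interpret B: group B by fact
  let ?P = "product_group {..<k} S"
  let ?Q = "?P \<times>\<times> S k"
  have S: "simple_group (S j)" "group (S j)" if "j \<le> k" for j
    using Suc.prems(1) that by (auto simp: simple_group_def)
  have P: "group ?P" using S by (intro product_group) auto
  then have Q: "group ?Q" using S by (auto intro: DirProd_group)
  \<comment> \<open>Replacing the product over \<open>Suc k\<close> indices by a binary product
    makes the two parts visible as the coordinate subgroups \<open>?A\<close> and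
    \<open>?T\<close>.\<close>
  obtain F where F: "F \<in> epi ?Q B"
  proof -
    have "(\<lambda>(x, y). x(k := y)) \<in> epi ?Q (product_group {..<Suc k} S)"
      using product_group_Suc_iso[of k S] S by (simp add: iso_iff_mon_epi less_Suc_eq_le)
    then show ?thesis using epi_compose[OF _ Suc.prems(2)] that by blast
  qed
  then have Fh: "F \<in> hom ?Q B" and Fs: "F ` carrier ?Q = carrier B" by (auto simp: epi_def)
  let ?A = "carrier ?P \<times> {\<one>\<^bsub>S k\<^esub>}" and ?T = "{\<one>\<^bsub>?P\<^esub>} \<times> carrier (S k)"
  have nA: "?A \<lhd> ?Q" and nT: "?T \<lhd> ?Q"
    using P S(2)[of k]
    by (intro group.DirProd_normal[OF P] group.carrier_normal group.one_is_normal; simp)+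
  have mult: "F (x \<otimes>\<^bsub>?Q\<^esub> y) = F x \<otimes>\<^bsub>B\<^esub> F y" if "x \<in> carrier ?Q" "y \<in> carrier ?Q" for x y
    using Fh that by (rule hom_mult)
  have A: "F ` ?A \<lhd> B" and T: "F ` ?T \<lhd> B"
    using normal_image_epi[OF Q Suc.prems(3) F] nA nT by auto
  have gA: "group (B\<lparr>carrier := F ` ?A\<rparr>)" and gT: "group (B\<lparr>carrier := F ` ?T\<rparr>)"
    using A T B.subgroup_imp_group normal_imp_subgroup by blast+
  have "F \<in> epi (?Q\<lparr>carrier := ?A\<rparr>) (B\<lparr>carrier := F ` ?A\<rparr>)"
    using epi_restrict(1)[OF Q Suc.prems(3) Fh normal_imp_subgroup[OF nA]] .
  moreover have "(\<lambda>x. (x, \<one>\<^bsub>S k\<^esub>)) \<in> epi ?P (?Q\<lparr>carrier := ?A\<rparr>)"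
    by (rule DirProd_epi_factors(1)[OF P S(2)[OF order_refl]])
  ultimately have psA: "product_of_simples (B\<lparr>carrier := F ` ?A\<rparr>)"
    using Suc.IH[OF S(1) _ gA] epi_compose by fastforce
  have "F \<in> epi (?Q\<lparr>carrier := ?T\<rparr>) (B\<lparr>carrier := F ` ?T\<rparr>)"
    using epi_restrict(1)[OF Q Suc.prems(3) Fh normal_imp_subgroup[OF nT]] .
  moreover have "(\<lambda>x. (\<one>\<^bsub>?P\<^esub>, x)) \<in> epi (S k) (?Q\<lparr>carrier := ?T\<rparr>)"
    by (rule DirProd_epi_factors(2)[OF P S(2)[OF order_refl]])
  ultimately have "simple_group (B\<lparr>carrier := F ` ?T\<rparr>) \<or> F ` ?T = {\<one>\<^bsub>B\<^esub>}"
    using epi_simple_group[OF S(1)[of k] gT] epi_compose by fastforce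
  moreover have "carrier B = F ` ?A <#>\<^bsub>B\<^esub> F ` ?T"
  proof
    show "F ` ?A <#>\<^bsub>B\<^esub> F ` ?T \<subseteq> carrier B"
      using A T normal_imp_subgroup subgroup.subset B.setmult_subset_G by meson
    show "carrier B \<subseteq> F ` ?A <#>\<^bsub>B\<^esub> F ` ?T"
    proof
      fix b assume "b \<in> carrier B"
      then have "b \<in> F ` carrier ?Q" unfolding Fs .
      then obtain x y where xy: "x \<in> carrier ?P" "y \<in> carrier (S k)" "b = F (x, y)"
        by (auto simp del: carrier_product_group)
      have one: "\<one>\<^bsub>S k\<^esub> \<in> carrier (S k)" "\<one>\<^bsub>?P\<^esub> \<in> carrier ?P"
        using group.is_monoid[OF P] group.is_monoid[OF S(2)[of k]] monoid.one_closed by blast+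
      \<comment> \<open>Every element is a product of elements of the two coordinate subgroups;
        applying \<open>F\<close> writes \<open>b\<close> as a product of elements of their
        images.\<close>
      have "(x, y) = (x, \<one>\<^bsub>S k\<^esub>) \<otimes>\<^bsub>?Q\<^esub> (\<one>\<^bsub>?P\<^esub>, y)"
        using xy group.is_monoid[OF P] group.is_monoid[OF S(2)[of k]]
        by (simp add: monoid.r_one monoid.l_one del: one_product_group mult_product_group carrier_product_group)
      then have "b = F (x, \<one>\<^bsub>S k\<^esub>) \<otimes>\<^bsub>B\<^esub> F (\<one>\<^bsub>?P\<^esub>, y)"
        using mult[of "(x, \<one>\<^bsub>S k\<^esub>)" "(\<one>\<^bsub>?P\<^esub>, y)"] one xy by simp
      then show "b \<in> F ` ?A <#>\<^bsub>B\<^esub> F ` ?T" using xy unfolding set_mult_def by blast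
    qed
  qed
  ultimately consider "simple_group (B\<lparr>carrier := F ` ?T\<rparr>)" "carrier B = F ` ?A <#>\<^bsub>B\<^esub> F ` ?T"
    | "F ` ?T = {\<one>\<^bsub>B\<^esub>}" "carrier B = F ` ?A <#>\<^bsub>B\<^esub> F ` ?T" by blast
  then show ?case
  proof cases
    case 1
    have "product_of_simples (B\<lparr>carrier := F ` ?A <#>\<^bsub>B\<^esub> F ` ?T\<rparr>)"
      using B.product_of_simples_join[OF A B.simple_normal_imp_minimal_normal[OF T 1(1)] psA
          simple_imp_product_of_simples[OF 1(1)]] .
    then show ?thesis unfolding 1(2)[symmetric] by simp
  next
    case 2
    have "F ` ?A <#>\<^bsub>B\<^esub> {\<one>\<^bsub>B\<^esub>} = F ` ?A"
      using B.set_mult_least[of "F ` ?A" "F ` ?A" "{\<one>\<^bsub>B\<^esub>}"] B.set_mult_normal_upper(1)[OF A B.one_is_normal]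
        normal_imp_subgroup[OF A] subgroup.one_closed[OF normal_imp_subgroup[OF A]] by blast
    then have "carrier B = F ` ?A" using 2 by simp
    then show ?thesis using psA by (metis partial_object.surjective partial_object.update_convs(1))
  qed
qed

lemma product_of_simples_epi:
  assumes "product_of_simples A" "group A" "f \<in> epi A B" "group B"
  shows "product_of_simples B"
proof -
  obtain k :: nat and S :: "nat \<Rightarrow> nat monoid"
    where S: "\<And>j. j < k \<Longrightarrow> simple_group (S j)" "A \<cong> product_group {..<k} S"
    using assms(1) unfolding product_of_simples_def by blast
  then obtain g where "g \<in> epi (product_group {..<k} S) A"
    using group.iso_sym[OF assms(2)] iso_obtain_epi by blast
  then show ?thesis
    using product_of_simples_epi_product_group[of k S, OF S(1) epi_compose[OF _ assms(3)] assms(4)] by blast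
qed

section \<open>Minimal normal subgroups and the socle\<close>

lemma iso_restrict:
  assumes "group G" "group H" "f \<in> iso G H" "subgroup S G"
  shows "G\<lparr>carrier := S\<rparr> \<cong> H\<lparr>carrier := f ` S\<rparr>"
proof (rule is_isoI)
  have f: "f \<in> hom G H" "inj_on f (carrier G)" using assms(3) by (auto simp: iso_def bij_betw_def)
  then have "inj_on f S" using subgroup.subset[OF assms(4)] inj_on_subset by blast
  then show "f \<in> iso (G\<lparr>carrier := S\<rparr>) (H\<lparr>carrier := f ` S\<rparr>)"
    using epi_restrict(1)[OF assms(1,2) f(1) assms(4)] by (simp add: iso_def epi_def bij_betw_def)
qed

lemma minimal_normal_iso_image:
  assumes "group G" "group H" "f \<in> iso G H" "minimal_normal S G"
  shows "minimal_normal (f ` S) H"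
proof -
  have f: "f \<in> epi G H" "inj_on f (carrier G)" using assms(3) by (auto simp: iso_iff_mon_epi mon_def)
  have S: "S \<lhd> G" "S \<noteq> {\<one>\<^bsub>G\<^esub>}" "S \<subseteq> carrier G"
    using assms(4) normal_imp_subset[of S G] by (auto simp: minimal_normal_def)
  have f1: "f \<one>\<^bsub>G\<^esub> = \<one>\<^bsub>H\<^esub>" using f(1) assms(1,2) by (auto simp: epi_def hom_one)
  have one: "\<one>\<^bsub>G\<^esub> \<in> S" using S(1) normal_imp_subgroup subgroup.one_closed by blast
  have "f ` S \<noteq> {\<one>\<^bsub>H\<^esub>}"
  proof
    assume *: "f ` S = {\<one>\<^bsub>H\<^esub>}"
    have "x = \<one>\<^bsub>G\<^esub>" if "x \<in> S" for x
    proof -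
      have "f x = f \<one>\<^bsub>G\<^esub>" using that * f1 by auto
      then show ?thesis using inj_onD[OF f(2)] that one S(3) by blast
    qed
    then show False using S(2) one by blast
  qed
  moreover have "M = {\<one>\<^bsub>H\<^esub>} \<or> M = f ` S" if M: "M \<lhd> H" "M \<subseteq> f ` S" for M
  proof -
    let ?L = "{x \<in> carrier G. f x \<in> M}"
    have L: "?L \<lhd> G" using mod_preimage(1)[OF assms(1,2) M(1) f(1)] by simp
    have sub: "?L \<subseteq> S"
    proof
      fix x assume x: "x \<in> ?L"
      then obtain s where "s \<in> S" "f x = f s" using M(2) by blast
      then show "x \<in> S" using inj_onD[OF f(2), of x s] x S(3) by auto
    qed
    have "M \<subseteq> f ` carrier G" using M(2) S(3) by blast
    then have "M = f ` ?L" by blast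
    moreover have "?L = {\<one>\<^bsub>G\<^esub>} \<or> ?L = S" using L sub assms(4) unfolding minimal_normal_def by blast
    ultimately show ?thesis using f1 by fastforce
  qed
  ultimately show ?thesis
    using normal_image_epi[OF assms(1,2) f(1) S(1)] by (simp add: minimal_normal_def)
qed

text \<open>The subgroups are adjoined one at a time. Each new one is minimal normal, so
  \<open>product_of_simples_join\<close> handles its product with the normal subgroup generated so
  far.\<close>

lemma (in group) generate_minimal_normals:
  assumes "finite \<M>" "\<And>N. N \<in> \<M> \<Longrightarrow> minimal_normal N G"
    and "\<And>N. N \<in> \<M> \<Longrightarrow> product_of_simples (G\<lparr>carrier := N\<rparr>)"
  shows "generate G (\<Union>\<M>) \<lhd> G \<and> product_of_simples (G\<lparr>carrier := generate G (\<Union>\<M>)\<rparr>)"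
  using assms
proof (induction \<M> rule: finite_induct)
  case empty
  have "generate G {} = {\<one>}" by (rule generate_empty)
  moreover have "product_of_simples (G\<lparr>carrier := {\<one>}\<rparr>)"
    using subgroup_imp_group[OF triv_subgroup] by (intro product_of_simples_trivial) auto
  ultimately show ?case using one_is_normal by simp
next
  case (insert N \<M>)
  let ?K = "generate G (\<Union>\<M>)"
  have K: "?K \<lhd> G" "product_of_simples (G\<lparr>carrier := ?K\<rparr>)" using insert by auto
  have N: "minimal_normal N G" "N \<lhd> G" using insert.prems by (auto simp: minimal_normal_def)
  have car: "M \<subseteq> carrier G" if "M \<in> insert N \<M>" for M
    using insert.prems(1)[OF that] normal_imp_subset[of M G] by (simp add: minimal_normal_def)
  have KN: "?K <#> N \<lhd> G" using normal_set_mult K(1) N(2) by blast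
  have "generate G (\<Union>(insert N \<M>)) = ?K <#> N"
  proof
    have "\<Union>\<M> \<subseteq> ?K" by (auto intro: generate.incl)
    then show "generate G (\<Union>(insert N \<M>)) \<subseteq> ?K <#> N"
      using set_mult_normal_upper[OF K(1) N(2)] KN
      by (intro generate_subgroup_incl) (auto dest: normal_imp_subgroup)
    show "?K <#> N \<subseteq> generate G (\<Union>(insert N \<M>))"
      using car by (intro set_mult_least mono_generate generate_is_subgroup) (auto intro: generate.incl)
  qed
  then show ?case using KN product_of_simples_join[OF K(1) N(1) K(2)] insert.prems(2) by simp
qed

lemma (in group) conjugation_iso:
  assumes "N \<lhd> G" "g \<in> carrier G"
  shows "(\<lambda>x. g \<otimes> x \<otimes> inv g) \<in> iso (G\<lparr>carrier := N\<rparr>) (G\<lparr>carrier := N\<rparr>)"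
proof (rule isoI)
  interpret normal N G by fact
  note c = subset[THEN subsetD]
  show "(\<lambda>x. g \<otimes> x \<otimes> inv g) \<in> hom (G\<lparr>carrier := N\<rparr>) (G\<lparr>carrier := N\<rparr>)"
  proof (rule homI)
    fix x y assume "x \<in> carrier (G\<lparr>carrier := N\<rparr>)" "y \<in> carrier (G\<lparr>carrier := N\<rparr>)"
    then have "x \<in> carrier G" "y \<in> carrier G" using c by auto
    then have "g \<otimes> (x \<otimes> y) \<otimes> inv g = (g \<otimes> x \<otimes> inv g) \<otimes> (g \<otimes> y \<otimes> inv g)"
      using assms(2) by (simp add: m_assoc inv_solve_left)
    then show "g \<otimes> (x \<otimes>\<^bsub>G\<lparr>carrier := N\<rparr>\<^esub> y) \<otimes> inv g = (g \<otimes> x \<otimes> inv g) \<otimes>\<^bsub>G\<lparr>carrier := N\<rparr>\<^esub> (g \<otimes> y \<otimes> inv g)"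
      by simp
  qed (use inv_op_closed2 assms in auto)
  have 1: "inv g \<otimes> (g \<otimes> x \<otimes> inv g) \<otimes> g = x" "g \<otimes> (inv g \<otimes> x \<otimes> g) \<otimes> inv g = x" if "x \<in> carrier G" for x
    using that assms(2) by (simp_all add: m_assoc) (simp_all add: m_assoc[symmetric])
  show "bij_betw (\<lambda>x. g \<otimes> x \<otimes> inv g) (carrier (G\<lparr>carrier := N\<rparr>)) (carrier (G\<lparr>carrier := N\<rparr>))"
    by (rule bij_betw_byWitness[where f' = "\<lambda>x. inv g \<otimes> x \<otimes> g"])
      (use 1 c inv_op_closed1 inv_op_closed2 assms in auto)
qed

text \<open>Induction on the order of \<open>N\<close>, with the ambient group varying: a minimal
  normal subgroup \<open>T\<close> of the group \<open>N\<close> is either \<open>N\<close>, which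
  is then simple, or smaller, so that the induction hypothesis applies to \<open>T\<close> inside
  \<open>N\<close>. In the second case such subgroups generate a nontrivial normal subgroup of
  \<open>G\<close>, which must be \<open>N\<close> because \<open>N\<close> is minimal.\<close>

lemma minimal_normal_product_of_simples:
  assumes "group G" "finite (carrier G)" "minimal_normal N G"
  shows "product_of_simples (G\<lparr>carrier := N\<rparr>)"
  using assms
proof (induction "card N" arbitrary: G N rule: less_induct)
  case less
  interpret group G by fact
  have N: "N \<lhd> G" "N \<noteq> {\<one>\<^bsub>G\<^esub>}" using less.prems(3) by (auto simp: minimal_normal_def)
  interpret N: normal N G by (rule N(1))
  let ?P = "G\<lparr>carrier := N\<rparr>"
  interpret P: group ?P using subgroup_imp_group[OF N.subgroup_axioms] .
  have fin: "finite N" using less.prems(2) N.subset finite_subset by blast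
  obtain T where T: "minimal_normal T ?P" using P.minimal_normal_exists fin N(2) by auto
  then have TN: "T \<lhd> ?P" "T \<noteq> {\<one>\<^bsub>G\<^esub>}" "T \<subseteq> N"
    using normal_imp_subset[of T ?P] by (auto simp: minimal_normal_def)
  show ?case
  proof (cases "T = N")
    case True
    have "simple_group ?P"
    proof (rule simple_groupI)
      fix H assume "H \<lhd> ?P"
      then show "H = carrier ?P \<or> H = {\<one>\<^bsub>?P\<^esub>}"
        using T True normal_imp_subset[of H ?P] by (auto simp: minimal_normal_def)
    qed (use P.is_group fin N(2) in auto)
    then show ?thesis by (rule simple_imp_product_of_simples)
  next
    case False
    then have "T \<subset> N" using TN(3) by blast
    then have psT: "product_of_simples (?P\<lparr>carrier := T\<rparr>)"
      using less.hyps[of T ?P] T fin P.is_group psubset_card_mono by auto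
    \<comment> \<open>Taking all such subgroups makes the family closed under conjugation by
      elements of \<open>G\<close>: conjugation restricts to an automorphism of \<open>N\<close> and
      preserves both defining conditions. So the generated subgroup \<open>?K\<close> is normal in
      \<open>G\<close>, not merely in \<open>N\<close>.\<close>
    let ?M = "{T. minimal_normal T ?P \<and> product_of_simples (?P\<lparr>carrier := T\<rparr>)}"
    let ?K = "generate ?P (\<Union>?M)"
    have MN: "\<Union>?M \<subseteq> N"
      using normal_imp_subset[of _ ?P] by (fastforce simp: minimal_normal_def)
    have "finite ?M"
      by (rule finite_subset[OF _ P.finite_normals]) (use fin in \<open>auto simp: minimal_normal_def\<close>)
    then have K: "?K \<lhd> ?P" "product_of_simples (?P\<lparr>carrier := ?K\<rparr>)"
      using P.generate_minimal_normals[of ?M] by blast+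
    have sub: "?K \<subseteq> N" using P.generate_incl MN by simp
    have "?K \<lhd> G"
    proof (rule normal_invI)
      show "subgroup ?K G" using incl_subgroup[OF N.subgroup_axioms normal_imp_subgroup[OF K(1)]] .
      fix g h assume g: "g \<in> carrier G" and h: "h \<in> ?K"
      let ?c = "\<lambda>x. g \<otimes>\<^bsub>G\<^esub> x \<otimes>\<^bsub>G\<^esub> inv\<^bsub>G\<^esub> g"
      have c: "?c \<in> iso ?P ?P" by (rule conjugation_iso[OF N(1) g])
      interpret c: group_hom ?P ?P ?c
        using c P.is_group by (simp add: group_hom_def group_hom_axioms_def iso_def)
      have "?c ` T \<in> ?M" if "T \<in> ?M" for T
      proof -
        have T: "minimal_normal T ?P" "product_of_simples (?P\<lparr>carrier := T\<rparr>)" "subgroup T ?P"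
          using that normal_imp_subgroup by (auto simp: minimal_normal_def)
        have "product_of_simples (?P\<lparr>carrier := ?c ` T\<rparr>)"
          using product_of_simples_iso[OF T(2) P.subgroup_imp_group[OF T(3)]
              iso_restrict[OF P.is_group P.is_group c T(3)]] .
        then show ?thesis using minimal_normal_iso_image[OF P.is_group P.is_group c T(1)] by simp
      qed
      then have "?c ` \<Union>?M \<subseteq> \<Union>?M" by blast
      then have "generate ?P (?c ` \<Union>?M) \<subseteq> ?K" by (rule P.mono_generate)
      moreover have "generate ?P (?c ` \<Union>?M) = ?c ` ?K"
        by (rule c.generate_img) (use MN in simp)
      ultimately have "?c ` ?K \<subseteq> ?K" by simp
      then show "?c h \<in> ?K" using h by blast
    qed
    moreover have "T \<subseteq> ?K" using T psT by (auto intro!: generate.incl)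
    then have "?K \<noteq> {\<one>\<^bsub>G\<^esub>}" using TN(2) normal_imp_subgroup[OF TN(1), THEN subgroup.one_closed] by auto
    ultimately have "?K = N" using less.prems(3) sub unfolding minimal_normal_def by blast
    then show ?thesis using K(2) by simp
  qed
qed

lemma (in group) socle_product_of_simples:
  assumes "finite (carrier G)"
  shows "socle G \<lhd> G" "product_of_simples (G\<lparr>carrier := socle G\<rparr>)"
proof -
  have "finite {N. minimal_normal N G}"
    by (rule finite_subset[OF _ finite_normals[OF assms]]) (auto simp: minimal_normal_def)
  then have "socle G \<lhd> G \<and> product_of_simples (G\<lparr>carrier := socle G\<rparr>)"
    unfolding socle_def
    by (rule generate_minimal_normals)
      (use minimal_normal_product_of_simples[OF is_group assms] in auto)
  then show "socle G \<lhd> G" "product_of_simples (G\<lparr>carrier := socle G\<rparr>)" by auto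
qed

section \<open>Series whose factors are products of simple groups\<close>

lemma trivial_FactGroup:
  assumes "group G" shows "carrier (G Mod carrier G) = {\<one>\<^bsub>G Mod carrier G\<^esub>}"
proof -
  interpret group G by fact
  show ?thesis
    using coset_join2[OF _ subgroup_self] one_closed unfolding carrier_FactGroup one_FactGroup by blast
qed

lemma (in group) product_of_simples_Mod_carrier: "product_of_simples (G Mod carrier G)"
  using product_of_simples_trivial normal.factorgroup_is_group[OF carrier_normal]
    trivial_FactGroup[OF is_group] by blast

text \<open>The preimage \<open>L\<close> is the union of the cosets in \<open>A\<close>. The last
  claim is an equality and not just an isomorphism, because the elements of both sides are the same
  cosets of \<open>H\<close>; factors of a series can thus be rewritten directly.\<close>

lemma (in normal) FactGroup_restrict:
  assumes "subgroup A (G Mod H)" "L = {x \<in> carrier G. H #> x \<in> A}"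
  shows "subgroup L G" "H \<lhd> G\<lparr>carrier := L\<rparr>" "G\<lparr>carrier := L\<rparr> Mod H = (G Mod H)\<lparr>carrier := A\<rparr>"
proof -
  have L: "L = \<Union>A" using factgroup_subgroup_union_char[OF assms(1)] assms(2) by simp
  show sub: "subgroup L G" unfolding L by (rule factgroup_subgroup_union_subgroup[OF assms(1)])
  have "\<one>\<^bsub>G Mod H\<^esub> \<in> A" using assms(1) by (rule subgroup.one_closed)
  then have "H \<subseteq> L" unfolding L by auto
  then show "H \<lhd> G\<lparr>carrier := L\<rparr>" by (intro normal_restrict_supergroup sub normal_axioms)
  have "A = rcosets\<^bsub>G\<lparr>carrier := L\<rparr>\<^esub> H"
    using factgroup_subgroup_union_factor[OF assms(1)] L by simp
  then show "G\<lparr>carrier := L\<rparr> Mod H = (G Mod H)\<lparr>carrier := A\<rparr>"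
    by (simp add: FactGroup_def set_mult_def fun_eq_iff)
qed

lemma (in normal) epi_Mod: "(\<lambda>x. H #> x) \<in> epi G (G Mod H)"
  using r_coset_hom_Mod by (simp add: epi_def carrier_FactGroup)

text \<open>\<open>mu\<close> is the least \<open>l\<close> with this property. Working with the
  predicate allows series that are not shortest, which induction on \<open>l\<close> and padding
  require.\<close>

definition has_simples_series :: "('a, 'b) monoid_scheme \<Rightarrow> nat \<Rightarrow> bool" where
  "has_simples_series G l \<longleftrightarrow>
     (\<exists>V. subnormal_series G l V \<and> (\<forall>i<l. product_of_simples (series_factor G V i)))"

lemma mu_eq_Least: "mu G = (LEAST l. has_simples_series G l)"
  by (simp add: mu_def has_simples_series_def)

lemma subnormal_series_SucD:
  assumes "subnormal_series G (Suc n) V"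
  shows "V n \<lhd> G" "subnormal_series (G\<lparr>carrier := V n\<rparr>) n V"
    "series_factor G V n = G Mod V n"
    "series_factor (G\<lparr>carrier := V n\<rparr>) V i = series_factor G V i"
  using assms by (auto simp: subnormal_series_def series_factor_def)

lemma subnormal_series_SucI:
  assumes "N \<lhd> G" "subnormal_series (G\<lparr>carrier := N\<rparr>) n V"
  defines "W \<equiv> V(Suc n := carrier G)"
  shows "subnormal_series G (Suc n) W"
    and "series_factor G W n = G Mod N"
    and "i < n \<Longrightarrow> series_factor G W i = series_factor (G\<lparr>carrier := N\<rparr>) V i"
  using assms by (auto simp: subnormal_series_def series_factor_def less_Suc_eq)

lemma has_simples_series_0: "has_simples_series G 0 \<longleftrightarrow> carrier G = {\<one>\<^bsub>G\<^esub>}"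
  by (auto simp: has_simples_series_def subnormal_series_def)

lemma has_simples_series_SucE:
  assumes "has_simples_series G (Suc l)"
  obtains N where "N \<lhd> G" "has_simples_series (G\<lparr>carrier := N\<rparr>) l" "product_of_simples (G Mod N)"
proof -
  obtain V where V: "subnormal_series G (Suc l) V"
      "\<forall>i<Suc l. product_of_simples (series_factor G V i)"
    using assms by (auto simp: has_simples_series_def)
  note S = subnormal_series_SucD[OF V(1)]
  have "has_simples_series (G\<lparr>carrier := V l\<rparr>) l"
    unfolding has_simples_series_def using S V(2) by auto
  then show thesis using that S V(2) by fastforce
qed

lemma has_simples_series_SucI:
  assumes "N \<lhd> G" "has_simples_series (G\<lparr>carrier := N\<rparr>) l" "product_of_simples (G Mod N)"
  shows "has_simples_series G (Suc l)"
proof -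
  obtain V where V: "subnormal_series (G\<lparr>carrier := N\<rparr>) l V"
      "\<forall>i<l. product_of_simples (series_factor (G\<lparr>carrier := N\<rparr>) V i)"
    using assms by (auto simp: has_simples_series_def)
  note S = subnormal_series_SucI[OF assms(1) V(1)]
  show ?thesis
    unfolding has_simples_series_def using S V(2) assms(3) less_Suc_eq by metis
qed

text \<open>A series can be lengthened by repeating \<open>G\<close> at the top, since the trivial
  factor is an empty product.\<close>

lemma has_simples_series_mono:
  assumes "group G" "has_simples_series G l" "l \<le> m"
  shows "has_simples_series G m"
  using assms(3)
proof (induction m rule: dec_induct)
  case (step n)
  then show ?case
    using has_simples_series_SucI[of "carrier G" G n] group.carrier_normal[OF assms(1)]
      group.product_of_simples_Mod_carrier[OF assms(1)] by simp
qed (use assms in simp)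

text \<open>The images of the terms form a series of \<open>H\<close>, and each of its factors is a
  homomorphic image of the corresponding factor, hence again a product of simple groups.\<close>

lemma has_simples_series_epi:
  assumes "group G" "group H" "f \<in> epi G H" "has_simples_series G l"
  shows "has_simples_series H l"
  using assms
proof (induction l arbitrary: G H f)
  case 0
  then have "carrier H = {f \<one>\<^bsub>G\<^esub>}" by (auto simp: has_simples_series_0 epi_def)
  moreover have "f \<one>\<^bsub>G\<^esub> = \<one>\<^bsub>H\<^esub>" using 0 by (auto simp: epi_def hom_one)
  ultimately show ?case by (simp add: has_simples_series_0)
next
  case (Suc l)
  obtain N where N: "N \<lhd> G" "has_simples_series (G\<lparr>carrier := N\<rparr>) l" "product_of_simples (G Mod N)"
    using Suc.prems(4) by (rule has_simples_series_SucE)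
  have M: "f ` N \<lhd> H" using normal_image_epi Suc.prems N(1) by blast
  have "f \<in> hom G H" using Suc.prems(3) by (simp add: epi_def)
  then have "f \<in> epi (G\<lparr>carrier := N\<rparr>) (H\<lparr>carrier := f ` N\<rparr>)"
    using epi_restrict(1) Suc.prems(1,2) normal_imp_subgroup[OF N(1)] by blast
  then have 1: "has_simples_series (H\<lparr>carrier := f ` N\<rparr>) l"
    using Suc.IH N(2) Suc.prems(1,2) group.subgroup_imp_group normal_imp_subgroup N(1) M by metis
  obtain g where "g \<in> epi (G Mod N) (H Mod f ` N)"
    using mod_epi[OF Suc.prems(1,2) N(1) M Suc.prems(3)] by blast
  then have "product_of_simples (H Mod f ` N)"
    using product_of_simples_epi[OF N(3)] normal.factorgroup_is_group[OF N(1)]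
      normal.factorgroup_is_group[OF M] by blast
  then show ?case using has_simples_series_SucI[OF M 1] by blast
qed

text \<open>Two series of equal length are multiplied term by term; the factors are then the direct
  products of the factors.\<close>

lemma has_simples_series_DirProd:
  assumes "group G" "group H" "has_simples_series G l" "has_simples_series H l"
  shows "has_simples_series (G \<times>\<times> H) l"
  using assms
proof (induction l arbitrary: G H)
  case 0
  then show ?case by (simp add: has_simples_series_0)
next
  case (Suc l)
  obtain N where N: "N \<lhd> G" "has_simples_series (G\<lparr>carrier := N\<rparr>) l" "product_of_simples (G Mod N)"
    using Suc.prems(3) by (rule has_simples_series_SucE)
  obtain M where M: "M \<lhd> H" "has_simples_series (H\<lparr>carrier := M\<rparr>) l" "product_of_simples (H Mod M)"
    using Suc.prems(4) by (rule has_simples_series_SucE)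
  have NM: "N \<times> M \<lhd> G \<times>\<times> H" using group.DirProd_normal Suc.prems(1,2) N(1) M(1) by blast
  have eq: "(G \<times>\<times> H)\<lparr>carrier := N \<times> M\<rparr> = G\<lparr>carrier := N\<rparr> \<times>\<times> H\<lparr>carrier := M\<rparr>"
    by (simp add: DirProd_def)
  have 1: "has_simples_series ((G \<times>\<times> H)\<lparr>carrier := N \<times> M\<rparr>) l"
    unfolding eq
    using Suc.IH[OF _ _ N(2) M(2)] group.subgroup_imp_group[OF Suc.prems(1) normal_imp_subgroup[OF N(1)]]
      group.subgroup_imp_group[OF Suc.prems(2) normal_imp_subgroup[OF M(1)]] by blast
  have gr: "group (G Mod N)" "group (H Mod M)" using normal.factorgroup_is_group N(1) M(1) by blast+
  have "(G Mod N) \<times>\<times> (H Mod M) \<cong> (G \<times>\<times> H) Mod (N \<times> M)"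
    by (rule group.FactGroup_DirProd_multiplication_iso_1[OF Suc.prems(1,2) N(1) M(1)])
  then have "product_of_simples ((G \<times>\<times> H) Mod (N \<times> M))"
    using product_of_simples_iso[OF product_of_simples_DirProd[OF N(3) gr(1) M(3) gr(2)] DirProd_group[OF gr]]
    by blast
  then show ?case using has_simples_series_SucI[OF NM 1] by blast
qed

text \<open>Induction on the length of the series of the quotient. The term \<open>A\<close> just
  below its top pulls back to a subgroup \<open>L\<close> with \<open>L / N = A\<close>, to which
  the induction hypothesis applies, and \<open>G / L\<close> is isomorphic to the top factor of the
  quotient's series.\<close>

lemma has_simples_series_extension:
  assumes "group G" "N \<lhd> G" "has_simples_series (G\<lparr>carrier := N\<rparr>) a" "has_simples_series (G Mod N) b"
  shows "has_simples_series G (a + b)"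
  using assms
proof (induction b arbitrary: G)
  case 0
  then have car: "carrier (G Mod N) = {N}" by (simp add: has_simples_series_0)
  interpret normal N G by fact
  have "carrier G = N"
  proof -
    have "x \<in> N" if "x \<in> carrier G" for x
      using rcos_self[OF that subgroup_axioms] car that unfolding carrier_FactGroup by blast
    then show ?thesis using subset by blast
  qed
  then have "G\<lparr>carrier := N\<rparr> = G" by (simp flip: \<open>carrier G = N\<close>)
  then show ?case using 0 by simp
next
  case (Suc b)
  interpret group G by fact
  interpret N: normal N G by fact
  let ?Q = "G Mod N"
  have Q: "group ?Q" by (rule N.factorgroup_is_group)
  obtain A where A: "A \<lhd> ?Q" "has_simples_series (?Q\<lparr>carrier := A\<rparr>) b" "product_of_simples (?Q Mod A)"
    using Suc.prems(4) by (rule has_simples_series_SucE)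
  define L where "L = {x \<in> carrier G. N #>\<^bsub>G\<^esub> x \<in> A}"
  note L = N.FactGroup_restrict[OF normal_imp_subgroup[OF A(1)] L_def]
  have nL: "L \<lhd> G" and iso: "G Mod L \<cong> ?Q Mod A"
    using mod_preimage[OF is_group Q A(1) N.epi_Mod L_def] by auto
  have "has_simples_series (G\<lparr>carrier := L\<rparr>) (a + b)"
    using Suc.IH[OF subgroup_imp_group[OF L(1)] L(2)] Suc.prems(3) A(2) L(3) by simp
  moreover have "product_of_simples (G Mod L)"
    using product_of_simples_iso[OF A(3) normal.factorgroup_is_group[OF A(1)]]
      group.iso_sym[OF normal.factorgroup_is_group[OF nL] iso] by blast
  ultimately show ?case using has_simples_series_SucI[OF nL] by simp
qed

lemma (in group) has_simples_series_1:
  assumes "product_of_simples G"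
  shows "has_simples_series G 1"
proof -
  have "G Mod {\<one>} \<cong> G" using trivial_factor_iso by (rule is_isoI)
  then have "product_of_simples (G Mod {\<one>})"
    using product_of_simples_iso[OF assms is_group]
      group.iso_sym[OF normal.factorgroup_is_group[OF one_is_normal]] by blast
  moreover have "has_simples_series (G\<lparr>carrier := {\<one>}\<rparr>) 0" by (simp add: has_simples_series_0)
  ultimately show ?thesis using has_simples_series_SucI[OF one_is_normal] by simp
qed

section \<open>Complexity functions\<close>

lemma iso_finite: "G \<cong> H \<Longrightarrow> finite (carrier G) \<Longrightarrow> finite (carrier H)"
  using bij_betw_finite by (auto simp: is_iso_def iso_def)

lemma finite_FactGroup: "finite (carrier G) \<Longrightarrow> finite (carrier (G Mod N))"
  by (simp add: carrier_FactGroup)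

text \<open>The image of \<open>M\<close> in the simple quotient is everything or trivial. As
  \<open>M\<close> contains \<open>H\<close>, it is a union of cosets of \<open>H\<close>, so its
  image determines it.\<close>

lemma (in normal) simple_FactGroup_maximal:
  assumes "simple_group (G Mod H)" "M \<lhd> G" "H \<subseteq> M"
  shows "M = H \<or> M = carrier G"
proof -
  have Q: "group (G Mod H)" by (rule factorgroup_is_group)
  let ?f = "\<lambda>x. H #> x"
  have "?f ` M \<lhd> G Mod H" using normal_image_epi[OF is_group Q epi_Mod assms(2)] .
  then consider "?f ` M = carrier (G Mod H)" | "?f ` M = {H}"
    using simple_group.no_real_normal_subgroup[OF assms(1), of "?f ` M"] unfolding one_FactGroup by blast
  then show ?thesis
  proof cases
    case 1
    have "x \<in> M" if x: "x \<in> carrier G" for x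
    proof -
      have "H #> x \<in> ?f ` M" unfolding 1 using x by (simp add: carrier_FactGroup)
      then obtain m where m: "m \<in> M" "H #> x = H #> m" by blast
      then have "x \<in> H #> m" using rcos_self[OF x subgroup_axioms] by simp
      then obtain h where "h \<in> H" "x = h \<otimes> m" by (auto simp: r_coset_def)
      then show ?thesis
        using subgroup.m_closed[OF normal_imp_subgroup[OF assms(2)]] assms(3) m(1) by blast
    qed
    then show ?thesis using normal_imp_subset[OF assms(2)] by blast
  next
    case 2
    have "x \<in> H" if "x \<in> M" for x
      using rcos_self[of x, OF _ subgroup_axioms] 2 that normal_imp_subset[OF assms(2)] by blast
    then show ?thesis using assms(3) by blast
  qed
qed

section \<open>Existence of composition series\<close>

lemma (in group) simple_FactGroup_exists:
  assumes "finite (carrier G)" "carrier G \<noteq> {\<one>}"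
  shows "\<exists>N. N \<lhd> G \<and> N \<noteq> carrier G \<and> simple_group (G Mod N)"
proof -
  let ?X = "{N. N \<lhd> G \<and> N \<noteq> carrier G}"
  have "finite ?X" by (rule finite_subset[OF _ finite_normals[OF assms(1)]]) auto
  moreover have "?X \<noteq> {}" using one_is_normal assms(2) by blast
  \<comment> \<open>A maximal proper normal subgroup has a simple quotient: a normal subgroup of the
    quotient pulls back to one of \<open>G\<close> containing \<open>N\<close>, which is
    \<open>N\<close> or \<open>G\<close>.\<close>
  ultimately obtain N where N: "N \<in> ?X" "\<forall>M\<in>?X. N \<subseteq> M \<longrightarrow> N = M"
    using finite_has_maximal by meson
  interpret N: normal N G using N(1) by blast
  have Q: "group (G Mod N)" by (rule N.factorgroup_is_group)
  have "simple_group (G Mod N)"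
  proof (rule simple_groupI[OF Q])
    show "finite (carrier (G Mod N))" using assms(1) by (rule finite_FactGroup)
    show "carrier (G Mod N) \<noteq> {\<one>\<^bsub>G Mod N\<^esub>}" using N.fact_group_trivial_iff assms(1) N(1) by blast
    fix A assume A: "A \<lhd> G Mod N"
    let ?L = "{x \<in> carrier G. N #> x \<in> A}"
    have L: "?L \<lhd> G" using mod_preimage(1)[OF is_group Q A N.epi_Mod] by simp
    have "N \<in> A" using subgroup.one_closed[OF normal_imp_subgroup[OF A]] by simp
    then have NL: "N \<subseteq> ?L" using N.subset N.rcos_const by auto
    have "A \<subseteq> carrier (G Mod N)" using normal_imp_subset[OF A] .
    then have AL: "A = (\<lambda>x. N #> x) ` ?L" by (auto simp: carrier_FactGroup)
    consider "?L = carrier G" | "?L = N" using N(2) L NL by blast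
    then show "A = carrier (G Mod N) \<or> A = {\<one>\<^bsub>G Mod N\<^esub>}"
    proof cases
      case 1
      then show ?thesis using AL unfolding carrier_FactGroup by simp
    next
      case 2
      have "(\<lambda>x. N #> x) ` N = (\<lambda>x. N) ` N"
        by (rule image_cong) (use N.rcos_const in auto)
      also have "\<dots> = {N}" using N.one_closed by (rule image_constant)
      finally have "(\<lambda>x. N #> x) ` N = {N}" .
      then show ?thesis using AL unfolding 2 by simp
    qed
  qed
  then show ?thesis using N(1) by blast
qed

lemma composition_series_SucD:
  assumes "composition_series G (Suc n) V"
  shows "V n \<lhd> G" "composition_series (G\<lparr>carrier := V n\<rparr>) n V" "simple_group (G Mod V n)"
proof -
  have S: "subnormal_series G (Suc n) V" "\<forall>i<Suc n. simple_group (series_factor G V i)"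
    using assms by (auto simp: composition_series_def)
  note D = subnormal_series_SucD[OF S(1)]
  show "V n \<lhd> G" by (rule D(1))
  show "composition_series (G\<lparr>carrier := V n\<rparr>) n V"
    unfolding composition_series_def using D S(2) by auto
  show "simple_group (G Mod V n)" using D(3) S(2) by fastforce
qed

lemma composition_series_exists:
  assumes "group G" "finite (carrier G)"
  shows "\<exists>n V. composition_series G n V"
  using assms
proof (induction "card (carrier G)" arbitrary: G rule: less_induct)
  case less
  interpret group G by fact
  show ?case
  proof (cases "carrier G = {\<one>\<^bsub>G\<^esub>}")
    case True
    then have "composition_series G 0 (\<lambda>_. carrier G)"
      by (simp add: composition_series_def subnormal_series_def)
    then show ?thesis by blast
  next
    case False
    then obtain N where N: "N \<lhd> G" "N \<noteq> carrier G" "simple_group (G Mod N)"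
      using simple_FactGroup_exists less.prems(2) by blast
    have "N \<subset> carrier G" using N(2) normal_imp_subset[OF N(1)] by blast
    then have "card N < card (carrier G)" "finite N"
      using less.prems(2) psubset_card_mono finite_subset by auto
    then obtain n V where V: "composition_series (G\<lparr>carrier := N\<rparr>) n V"
      using less.hyps[of "G\<lparr>carrier := N\<rparr>"] subgroup_imp_group[OF normal_imp_subgroup[OF N(1)]] by auto
    then have "subnormal_series (G\<lparr>carrier := N\<rparr>) n V"
        "\<forall>i<n. simple_group (series_factor (G\<lparr>carrier := N\<rparr>) V i)"
      by (auto simp: composition_series_def)
    note S = subnormal_series_SucI[OF N(1) this(1)] and this(2)
    then have "composition_series G (Suc n) (V(Suc n := carrier G))"
      unfolding composition_series_def using N(3) less_Suc_eq by metis
    then show ?thesis by blast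
  qed
qed

lemma composition_series_imp_has_simples_series:
  "composition_series G n V \<Longrightarrow> has_simples_series G n"
  using simple_imp_product_of_simples unfolding composition_series_def has_simples_series_def by blast

section \<open>The length \<open>mu\<close> satisfies the complexity axioms\<close>

lemma has_simples_series_mu:
  assumes "group G" "finite (carrier G)" shows "has_simples_series G (mu G)"
  unfolding mu_eq_Least
  \<comment> \<open>A composition series is one of the competing series, so the minimum defining
    \<open>mu\<close> is attained.\<close>
  using composition_series_exists[OF assms] composition_series_imp_has_simples_series by (metis LeastI)

lemma mu_le: "has_simples_series G l \<Longrightarrow> mu G \<le> l"
  unfolding mu_eq_Least by (rule Least_le)

lemma mu_epi:
  assumes "group G" "finite (carrier G)" "group H" "f \<in> epi G H"
  shows "mu H \<le> mu G"
  using has_simples_series_epi[OF assms(1,3,4) has_simples_series_mu[OF assms(1,2)]] by (rule mu_le)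

lemma mu_iso:
  assumes "group G" "finite (carrier G)" "group H" "G \<cong> H"
  shows "mu G = mu H"
proof -
  have fin: "finite (carrier H)" using iso_finite assms(2,4) by blast
  obtain f g where "f \<in> epi G H" "g \<in> epi H G"
    using assms(4) group.iso_sym[OF assms(1,4)] iso_obtain_epi by metis
  then show ?thesis using mu_epi assms(1-3) fin by (metis le_antisym)
qed

lemma class_val_mu:
  assumes "group G" "finite (carrier G)" shows "class_val mu G = mu G"
  unfolding class_val_def using mu_iso[OF assms nat_copy_group[OF assms] nat_copy_iso[OF assms(2)]] by simp

lemma fst_epi: "group H \<Longrightarrow> fst \<in> epi (G \<times>\<times> H) G"
  and snd_epi: "group G \<Longrightarrow> snd \<in> epi (G \<times>\<times> H) H"
  using monoid.one_closed[OF group.is_monoid]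
  by (auto simp: epi_def hom_def mult_DirProd' image_def)

lemma mu_complexity_function: "complexity_function mu"
proof (rule complexity_function.intro)
  fix G :: "nat monoid" and N assume G: "group G" "finite (carrier G)" and N: "N \<lhd> G"
  have 1: "group (G\<lparr>carrier := N\<rparr>)" "group (G Mod N)"
    using group.subgroup_imp_group[OF G(1) normal_imp_subgroup[OF N]] normal.factorgroup_is_group[OF N] by auto
  have 2: "finite (carrier (G\<lparr>carrier := N\<rparr>))" "finite (carrier (G Mod N))"
    using finite_subset[OF normal_imp_subset[OF N] G(2)] finite_FactGroup[OF G(2)] by auto
  have "has_simples_series G (mu (G\<lparr>carrier := N\<rparr>) + mu (G Mod N))"
    using has_simples_series_extension[OF G(1) N has_simples_series_mu[OF 1(1) 2(1)]
        has_simples_series_mu[OF 1(2) 2(2)]] .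
  then show "mu G \<le> mu (G\<lparr>carrier := N\<rparr>) + class_val mu (G Mod N)"
    using mu_le class_val_mu[OF 1(2) 2(2)] by metis
next
  fix G H :: "nat monoid" and f
  assume "group G" "finite (carrier G)" "group H" "f \<in> epi G H"
  then show "mu H \<le> mu G" by (rule mu_epi)
next
  fix G :: "nat monoid" assume "group G" "finite (carrier G)"
  \<comment> \<open>Constructability is witnessed by a composition series: its factors are simple,
    so each has a series of length 1.\<close>
  then obtain n V where V: "composition_series G n V" using composition_series_exists by blast
  have "class_val mu (series_factor G V i) \<le> 1" if "i < n" for i
  proof -
    have s: "simple_group (series_factor G V i)" using V that by (simp add: composition_series_def)
    then have g: "group (series_factor G V i)" by (simp add: simple_group_def)
    show ?thesis
      using class_val_mu[OF g simple_group_finite[OF s]]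
        mu_le[OF group.has_simples_series_1[OF g simple_imp_product_of_simples[OF s]]] by simp
  qed
  then show "\<exists>n V. subnormal_series G n V \<and> (\<forall>i<n. class_val mu (series_factor G V i) \<le> 1)"
    using V unfolding composition_series_def by blast
next
  fix H K :: "nat monoid"
  assume H: "group H" "finite (carrier H)" and K: "group K" "finite (carrier K)"
  have g: "group (H \<times>\<times> K)" "finite (carrier (H \<times>\<times> K))" using H K DirProd_group by auto
  \<comment> \<open>Both series are padded to a common length before they are multiplied; the
    projections below give the reverse inequality.\<close>
  have "has_simples_series H (max (mu H) (mu K))" "has_simples_series K (max (mu H) (mu K))"
    using has_simples_series_mono[OF H(1) has_simples_series_mu[OF H]]
      has_simples_series_mono[OF K(1) has_simples_series_mu[OF K]] by auto
  then have "mu (H \<times>\<times> K) \<le> max (mu H) (mu K)"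
    using mu_le has_simples_series_DirProd H(1) K(1) by blast
  moreover have "mu H \<le> mu (H \<times>\<times> K)" "mu K \<le> mu (H \<times>\<times> K)"
    using mu_epi[OF g H(1) fst_epi[OF K(1)]] mu_epi[OF g K(1) snd_epi[OF H(1)]] by auto
  ultimately show "class_val mu (H \<times>\<times> K) = max (mu H) (mu K)"
    using class_val_mu[OF g] by simp
next
  fix G :: "nat monoid" assume "group G" "carrier G = {\<one>\<^bsub>G\<^esub>}"
  then show "mu G = 0" using mu_le[of G 0] by (simp add: has_simples_series_0)
qed

section \<open>Bounding an arbitrary complexity function by \<open>mu\<close>\<close>

lemma subnormal_series_simple_factor:
  assumes "simple_group S" "subnormal_series S n V"
  shows "\<exists>i<n. series_factor S V i \<cong> S"
  using assms
proof (induction n)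
  case 0
  then show ?case using simple_group.simple_not_triv[OF 0(1)] 0(2) by (auto simp: subnormal_series_def)
next
  case (Suc n)
  interpret simple_group S by fact
  note D = subnormal_series_SucD[OF Suc.prems(2)]
  \<comment> \<open>The term below the top is normal in \<open>S\<close>. If it is all of
    \<open>S\<close>, a shorter series of \<open>S\<close> remains; if it is trivial, the top factor
    is a copy of \<open>S\<close>.\<close>
  consider "V n = carrier S" | "V n = {\<one>\<^bsub>S\<^esub>}" using no_real_normal_subgroup[OF D(1)] by blast
  then show ?case
  proof cases
    case 1
    then show ?thesis using Suc.IH[OF Suc.prems(1)] D(2) less_Suc_eq by auto
  next
    case 2
    then show ?thesis using D(3) is_isoI[OF trivial_factor_iso] by auto
  qed
qed

text \<open>In contrast to \<open>class_val_iso\<close>, both groups may live over arbitrary types;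
  this is what quotients and product groups call for.\<close>

lemma (in complexity_function) class_val_cong:
  assumes "group G" "finite (carrier G)" "group H" "G \<cong> H"
  shows "class_val c G = class_val c H"
proof -
  have fin: "finite (carrier H)" using iso_finite assms(2,4) by blast
  show ?thesis
    using class_val_iso[OF assms(1,2) nat_copy_group[OF assms(3) fin] nat_copy_finite[OF fin]
        iso_trans[OF assms(4) nat_copy_iso[OF fin]]]
    by (simp add: class_val_def)
qed

lemma (in complexity_function) class_val_nat:
  "group G \<Longrightarrow> finite (carrier G) \<Longrightarrow> class_val c G = c G"
  using class_val_iso[OF _ _ _ _ iso_refl] by blast

lemma (in complexity_function) simple_le_1:
  assumes "simple_group S" shows "c S \<le> 1"
proof -
  have S: "group S" "finite (carrier S)" using assms simple_group_finite by (auto simp: simple_group_def)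
  obtain n V where V: "subnormal_series S n V" "\<forall>i<n. class_val c (series_factor S V i) \<le> 1"
    using constructability[OF S] by blast
  obtain i where i: "i < n" "series_factor S V i \<cong> S" using subnormal_series_simple_factor[OF assms V(1)] by blast
  have "V i \<lhd> S\<lparr>carrier := V (Suc i)\<rparr>" using V(1) i(1) by (simp add: subnormal_series_def)
  then have g: "group (series_factor S V i)" unfolding series_factor_def by (rule normal.factorgroup_is_group)
  have "S \<cong> series_factor S V i" using group.iso_sym[OF g i(2)] .
  then have "class_val c S = class_val c (series_factor S V i)" using class_val_cong[OF S g] by blast
  then show ?thesis using class_val_nat[OF S] V(2) i(1) by simp
qed

lemma (in complexity_function) product_group_le_1:
  fixes S :: "nat \<Rightarrow> nat monoid"
  assumes "\<And>j. j < k \<Longrightarrow> simple_group (S j)"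
  shows "class_val c (product_group {..<k::nat} S) \<le> 1"
  using assms
proof (induction k)
  case 0
  let ?P = "product_group {..<0::nat} S"
  \<comment> \<open>The axiom \<open>initial\<close> speaks of groups over \<open>nat\<close>, so
    the empty product is compared with a trivial group of that type.\<close>
  let ?T = "singleton_group (0::nat)"
  have "(\<lambda>_. \<lambda>_. undefined) \<in> iso ?T ?P"
    by (auto simp: iso_def hom_def bij_betw_def)
  moreover have "group ?P" by (intro product_group) simp
  ultimately have "class_val c ?T = class_val c ?P"
    using class_val_cong[OF singleton_group _ _ is_isoI] by simp
  moreover have "c ?T = 0" by (rule initial[OF singleton_group]) (simp add: singleton_group_def)
  ultimately show ?case using class_val_nat[of ?T] by simp
next
  case (Suc k)
  let ?P = "product_group {..<k} S"
  have S: "simple_group (S j)" "group (S j)" "finite (carrier (S j))" if "j \<le> k" for j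
  proof -
    show s: "simple_group (S j)" using Suc.prems that by simp
    then show "group (S j)" by (simp add: simple_group_def)
    show "finite (carrier (S j))" by (rule simple_group_finite[OF s])
  qed
  have P: "group ?P" "finite (carrier ?P)"
    using S by (auto intro: product_group intro!: finite_product_group_lessThan simp del: carrier_product_group)
  \<comment> \<open>The product axiom takes its factors over \<open>nat\<close>, whereas the
    elements of \<open>?P\<close> are functions; the copy of \<open>?P\<close> stands in for
    it.\<close>
  have n: "group (nat_copy ?P)" "finite (carrier (nat_copy ?P))"
    using nat_copy_group nat_copy_finite P by blast+
  have g: "group (nat_copy ?P \<times>\<times> S k)" "finite (carrier (nat_copy ?P \<times>\<times> S k))"
    using n S[of k] DirProd_group by auto
  have "nat_copy ?P \<times>\<times> S k \<cong> ?P \<times>\<times> S k"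
    by (rule group.DirProd_iso_trans[OF n(1) group.iso_sym[OF P(1) nat_copy_iso[OF P(2)]] iso_refl])
  also have "\<dots> \<cong> product_group {..<Suc k} S"
    by (rule is_isoI, rule product_group_Suc_iso) (use S in auto)
  finally have "class_val c (product_group {..<Suc k} S) = class_val c (nat_copy ?P \<times>\<times> S k)"
    using S by (intro class_val_cong[symmetric] g product_group) auto
  also have "\<dots> = max (c (nat_copy ?P)) (c (S k))"
    using product[OF n S(2,3)[OF order_refl]] .
  also have "\<dots> \<le> 1" using Suc simple_le_1[OF S(1)[OF order_refl]] by (simp add: class_val_def)
  finally show ?case .
qed

lemma (in complexity_function) product_of_simples_le_1:
  assumes "group G" "finite (carrier G)" "product_of_simples G"
  shows "class_val c G \<le> 1"
proof -
  obtain k :: nat and S :: "nat \<Rightarrow> nat monoid"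
    where S: "\<And>j. j < k \<Longrightarrow> simple_group (S j)" "G \<cong> product_group {..<k} S"
    using assms(3) unfolding product_of_simples_def by blast
  have "group (product_group {..<k} S)" using S(1) by (intro product_group) (auto simp: simple_group_def)
  then have "class_val c G = class_val c (product_group {..<k} S)"
    using class_val_cong[OF assms(1,2)] S(2) by blast
  also have "\<dots> \<le> 1" using product_group_le_1 S(1) by blast
  finally show ?thesis .
qed

text \<open>Each factor of the series contributes at most 1 through the extension axiom.\<close>

lemma (in complexity_function) le_length:
  assumes "group G" "finite (carrier G)" "has_simples_series G l"
  shows "c G \<le> l"
  using assms
proof (induction l arbitrary: G)
  case 0
  then show ?case using initial by (simp add: has_simples_series_0)
next
  case (Suc l)
  obtain N where N: "N \<lhd> G" "has_simples_series (G\<lparr>carrier := N\<rparr>) l" "product_of_simples (G Mod N)"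
    using Suc.prems(3) by (rule has_simples_series_SucE)
  have "finite N" using finite_subset[OF normal_imp_subset[OF N(1)] Suc.prems(2)] .
  then have "c (G\<lparr>carrier := N\<rparr>) \<le> l"
    using Suc.IH[OF group.subgroup_imp_group[OF Suc.prems(1) normal_imp_subgroup[OF N(1)]] _ N(2)] by simp
  moreover have "class_val c (G Mod N) \<le> 1"
    by (rule product_of_simples_le_1[OF normal.factorgroup_is_group[OF N(1)] finite_FactGroup[OF Suc.prems(2)] N(3)])
  ultimately show ?case using extension[OF Suc.prems(1,2) N(1)] by simp
qed

lemma cx_eq_mu:
  assumes "group G" "finite (carrier G)"
  shows "cx G = enat (mu G)"
proof (rule antisym)
  have "class_val c G \<le> mu G" if "complexity_function c" for c
  proof -
    interpret complexity_function c by fact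
    show ?thesis
      \<comment> \<open>\<open>le_length\<close> is applied to the copy of \<open>G\<close> over
        \<open>nat\<close>, whose \<open>mu\<close> is that of \<open>G\<close> by
        \<open>class_val_mu\<close>.\<close>
      using le_length[OF nat_copy_group[OF assms] nat_copy_finite[OF assms(2)]
          has_simples_series_mu[OF nat_copy_group[OF assms] nat_copy_finite[OF assms(2)]]]
        class_val_mu[OF assms]
      by (simp add: class_val_def)
  qed
  then show "cx G \<le> enat (mu G)" unfolding cx_def by (intro Sup_least) auto
  \<comment> \<open>Since \<open>mu\<close> is itself a complexity function, it is a member of the
    set whose supremum is taken.\<close>
  have "enat (class_val mu G) \<le> cx G"
    unfolding cx_def by (rule Sup_upper) (use mu_complexity_function in blast)
  then show "enat (mu G) \<le> cx G" using class_val_mu[OF assms] by simp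
qed

section \<open>Socle series, chief series and composition series\<close>

lemma (in group) socle_series_normal:
  assumes "finite (carrier G)" shows "socle_series G i \<lhd> G"
proof (induction i)
  case 0
  then show ?case using one_is_normal by simp
next
  case (Suc i)
  interpret V: normal "socle_series G i" G by fact
  have Q: "group (G Mod socle_series G i)" by (rule V.factorgroup_is_group)
  show ?case
    using mod_preimage(1)[OF is_group Q group.socle_product_of_simples(1)[OF Q finite_FactGroup[OF assms]] V.epi_Mod]
    by simp
qed

text \<open>By \<open>FactGroup_restrict\<close> the top factor of this series is exactly the socle
  of the quotient by the preceding term, hence a product of simple groups.\<close>

lemma (in group) socle_series_has_simples_series:
  assumes "finite (carrier G)" shows "has_simples_series (G\<lparr>carrier := socle_series G i\<rparr>) i"
proof (induction i)
  case 0
  then show ?case by (simp add: has_simples_series_0)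
next
  case (Suc i)
  let ?V = "socle_series G i"
  interpret V: normal ?V G by (rule socle_series_normal[OF assms])
  have Q: "group (G Mod ?V)" by (rule V.factorgroup_is_group)
  note soc = group.socle_product_of_simples[OF Q finite_FactGroup[OF assms]]
  note R = V.FactGroup_restrict[OF normal_imp_subgroup[OF soc(1)] socle_series.simps(2)]
  show ?case using has_simples_series_SucI[OF R(2)] R(3) Suc soc(2) by simp
qed

text \<open>Since \<open>H i\<close> lies in the \<open>i\<close>-th socle term by induction, the
  image of \<open>H (Suc i)\<close> in the quotient by that term is trivial or minimal normal. In
  either case it lies in the socle of the quotient.\<close>

lemma (in group) chief_series_subset_socle_series:
  assumes "finite (carrier G)" "chief_series G n H" "i \<le> n"
  shows "H i \<subseteq> socle_series G i"
  using assms(3)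
proof (induction i)
  case 0
  then show ?case using assms(2) by (simp add: chief_series_def)
next
  case (Suc i)
  let ?V = "socle_series G i" and ?K = "H (Suc i)"
  let ?Q = "G Mod ?V" and ?f = "\<lambda>x. ?V #> x"
  interpret V: normal ?V G by (rule socle_series_normal[OF assms(1)])
  have Q: "group ?Q" by (rule V.factorgroup_is_group)
  have IH: "H i \<subseteq> ?V" using Suc by simp
  have K: "?K \<lhd> G" and HK: "H i \<subseteq> ?K"
    using assms(2) Suc.prems Suc_le_eq[of i n] by (simp_all add: chief_series_def less_imp_le)
  have chief: "M = H i \<or> M = ?K" if "M \<lhd> G" "H i \<subseteq> M" "M \<subseteq> ?K" for M
    using assms(2) Suc.prems that unfolding chief_series_def by (meson Suc_le_eq)
  have sub: "?K \<subseteq> carrier G" using normal_imp_subset[OF K] .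
  have soc: "socle ?Q \<lhd> ?Q"
    by (rule group.socle_product_of_simples(1)[OF Q finite_FactGroup[OF assms(1)]])
  have f1: "?f x = ?V" if "x \<in> ?V" for x using V.rcos_const that by simp
  have "?f ` ?K \<subseteq> socle ?Q"
  proof (cases "?K \<subseteq> ?V")
    case True
    have "?V \<in> socle ?Q" using subgroup.one_closed[OF normal_imp_subgroup[OF soc]] by simp
    then show ?thesis using f1 True by (intro image_subsetI) auto
  next
    case False
    have "minimal_normal (?f ` ?K) ?Q"
      unfolding minimal_normal_def
    proof (intro conjI allI impI)
      show "?f ` ?K \<lhd> ?Q" using normal_image_epi[OF is_group Q V.epi_Mod K] .
      obtain x where x: "x \<in> ?K" "x \<notin> ?V" using False by blast
      then have "x \<in> ?f x" using rcos_self[OF _ V.subgroup_axioms] sub by blast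
      then have "?f x \<noteq> ?V" using x(2) by blast
      then show "?f ` ?K \<noteq> {\<one>\<^bsub>?Q\<^esub>}" using x(1) by auto
      fix M assume "M \<lhd> ?Q \<and> M \<subseteq> ?f ` ?K"
      then have M: "M \<lhd> ?Q" "M \<subseteq> ?f ` ?K" by auto
      \<comment> \<open>Pulling \<open>M\<close> back and cutting down to \<open>?K\<close> gives a
        normal subgroup of \<open>G\<close> between \<open>H i\<close> and \<open>H (Suc i)\<close>,
        so the chief condition leaves two cases.\<close>
      let ?L = "{x \<in> carrier G. ?f x \<in> M}"
      have one: "?V \<in> M" using subgroup.one_closed[OF normal_imp_subgroup[OF M(1)]] by simp
      have "?L \<lhd> G" using mod_preimage(1)[OF is_group Q M(1) V.epi_Mod] by simp
      then have "?L \<inter> ?K \<lhd> G" using K by (rule normal_subgroup_intersect)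
      moreover have "H i \<subseteq> ?L \<inter> ?K" using IH HK f1 one V.subset by auto
      ultimately consider "?L \<inter> ?K = H i" | "?L \<inter> ?K = ?K" using chief by blast
      moreover have M_eq: "M = ?f ` (?L \<inter> ?K)" using M(2) sub by blast
      ultimately show "M = {\<one>\<^bsub>?Q\<^esub>} \<or> M = ?f ` ?K"
      proof cases
        case 1
        have "M \<subseteq> ?f ` ?V" using M_eq IH unfolding 1 by blast
        then have "M = {?V}" using f1 one by auto
        then show ?thesis by simp
      qed (use M_eq in metis)
    qed
    then show ?thesis unfolding socle_def by (auto intro: generate.incl)
  qed
  then show ?case using sub by auto
qed

section \<open>Chains of normal subgroups compared with composition series\<close>

lemma card_normal_chain_le:
  assumes "group G" "composition_series G m V" "finite C" "\<And>A. A \<in> C \<Longrightarrow> A \<lhd> G"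
    and "\<And>A B. A \<in> C \<Longrightarrow> B \<in> C \<Longrightarrow> A \<subseteq> B \<or> B \<subseteq> A"
  shows "card C \<le> Suc m"
  using assms
proof (induction m arbitrary: G C)
  case 0
  \<comment> \<open>The bound is \<open>Suc m\<close> because members are counted, not steps: the
    trivial group alone already allows a chain with one member.\<close>
  then have "carrier G = {\<one>\<^bsub>G\<^esub>}" by (auto simp: composition_series_def subnormal_series_def)
  then have "A = {\<one>\<^bsub>G\<^esub>}" if "A \<in> C" for A
    using subgroup.one_closed[OF normal_imp_subgroup] normal_imp_subset[of A G] 0(4)[OF that] by blast
  then have "C \<subseteq> {{\<one>\<^bsub>G\<^esub>}}" by blast
  then show ?case using card_mono[of "{{\<one>\<^bsub>G\<^esub>}}" C] by simp
next
  case (Suc m)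
  interpret group G by fact
  note D = composition_series_SucD[OF Suc.prems(2)]
  let ?N = "V m"
  interpret N: normal ?N G by (rule D(1))
  let ?f = "\<lambda>A. A \<inter> ?N"
  \<comment> \<open>Intersection with \<open>?N\<close> is injective on each of the two parts, and
    the two images share at most one set. By the induction hypothesis all the intersections together
    number at most \<open>Suc m\<close>, so \<open>C\<close> has at most one more member.\<close>
  let ?A = "{A \<in> C. A \<subseteq> ?N}" and ?B = "{A \<in> C. \<not> A \<subseteq> ?N}"
  note normal = Suc.prems(4) and chain = Suc.prems(5)
  have fin: "finite ?A" "finite ?B" using Suc.prems(3) by auto
  have restr: "A \<inter> ?N \<lhd> G\<lparr>carrier := ?N\<rparr>" if "A \<in> C" for A
    using normal[OF that] by (rule normal_Int_subgroup[OF N.subgroup_axioms])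
  have "card (?f ` C) \<le> Suc m"
    by (rule Suc.IH[OF subgroup_imp_group[OF N.subgroup_axioms] D(2)])
      (use Suc.prems(3) restr chain in blast)+
  moreover have "card (?f ` C) = card (?f ` ?A \<union> ?f ` ?B)"
    by (rule arg_cong[of _ _ card]) blast
  moreover have "card (?f ` ?A) = card ?A" by (rule card_image) (auto simp: inj_on_def)
  moreover have "card (?f ` ?B) = card ?B"
  proof (rule card_image, rule inj_onI)
    \<comment> \<open>Since \<open>A\<close> is not inside the maximal normal subgroup
      \<open>?N\<close>, the product of \<open>?N\<close> and \<open>A\<close> is \<open>G\<close>.
      Writing \<open>b\<close> as \<open>x\<close> times \<open>a\<close>, the part \<open>x\<close>
      lies in \<open>B\<close> and in \<open>?N\<close>, hence in \<open>A\<close>, and so does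
      \<open>b\<close>.\<close>
    have *: "B \<subseteq> A" if "A \<in> ?B" "B \<in> ?B" "?f A = ?f B" "A \<subseteq> B" for A B
    proof
      fix b assume b: "b \<in> B"
      have nA: "A \<lhd> G" and nB: "B \<lhd> G" using normal that by auto
      have "?N <#>\<^bsub>G\<^esub> A \<noteq> ?N"
        using set_mult_normal_upper(2)[OF D(1) nA] that(1) by blast
      then have "?N <#>\<^bsub>G\<^esub> A = carrier G"
        using N.simple_FactGroup_maximal[OF D(3) normal_set_mult[OF D(1) nA] set_mult_normal_upper(1)[OF D(1) nA]]
        by blast
      moreover have bc: "b \<in> carrier G" using b normal_imp_subset[OF nB] by blast
      ultimately obtain x a where xa: "x \<in> ?N" "a \<in> A" "b = x \<otimes>\<^bsub>G\<^esub> a"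
        unfolding set_mult_def by blast
      have ac: "a \<in> carrier G" "x \<in> carrier G" using xa normal_imp_subset[OF nA] N.subset by auto
      have "x = b \<otimes>\<^bsub>G\<^esub> inv\<^bsub>G\<^esub> a" using xa(3) ac by (simp add: m_assoc)
      then have "x \<in> B"
        using b xa(2) that(4) subgroup.m_closed[OF normal_imp_subgroup[OF nB]]
          subgroup.m_inv_closed[OF normal_imp_subgroup[OF nB]] by blast
      then have "x \<in> ?f B" using xa(1) by blast
      then have "x \<in> A" unfolding that(3)[symmetric] by blast
      then show "b \<in> A" using xa subgroup.m_closed[OF normal_imp_subgroup[OF nA]] by blast
    qed
    show "A = B" if "A \<in> ?B" "B \<in> ?B" "?f A = ?f B" for A B
    proof -
      have "A \<subseteq> B \<or> B \<subseteq> A" using chain that(1,2) by blast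
      then show ?thesis using *[OF that] *[OF that(2,1) that(3)[symmetric]] by (metis subset_antisym)
    qed
  qed
  moreover have "card (?f ` ?A \<inter> ?f ` ?B) \<le> 1"
  proof -
    \<comment> \<open>In the chain, a member inside \<open>?N\<close> lies below every member that
      is not. Two sets common to both images therefore contain each other.\<close>
    have *: "P \<subseteq> Q" if PQ: "P \<in> ?f ` ?A" "Q \<in> ?f ` ?B" for P Q
    proof -
      obtain A B where AB: "A \<in> ?A" "P = ?f A" "B \<in> ?B" "Q = ?f B" using PQ by blast
      then have "A \<subseteq> B" using chain[of A B] by auto
      then show ?thesis unfolding AB(2,4) by blast
    qed
    have uniq: "P = Q" if "P \<in> ?f ` ?A \<inter> ?f ` ?B" "Q \<in> ?f ` ?A \<inter> ?f ` ?B" for P Q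
      by (rule subset_antisym; rule *) (rule IntD1[OF that(1)] IntD2[OF that(2)] IntD1[OF that(2)] IntD2[OF that(1)])+
    have fin': "finite (?f ` ?A \<inter> ?f ` ?B)" using fin by simp
    show ?thesis unfolding One_nat_def card_le_Suc0_iff_eq[OF fin'] by (intro ballI uniq)
  qed
  moreover have "card (?f ` ?A) + card (?f ` ?B) = card (?f ` ?A \<union> ?f ` ?B) + card (?f ` ?A \<inter> ?f ` ?B)"
    using fin by (intro card_Un_Int) auto
  moreover have "card C = card ?A + card ?B"
  proof -
    have "C = ?A \<union> ?B" "?A \<inter> ?B = {}" by auto
    then show ?thesis using card_Un_disjoint[OF fin] by simp
  qed
  ultimately show ?case by linarith
qed

lemma chief_le_composition:
  assumes "group G" "chief_series G n H" "composition_series G m V"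
  shows "n \<le> m"
proof -
  have step: "H i \<subset> H (Suc i)" if "i < n" for i
    using assms(2) that by (simp add: chief_series_def)
  have less: "i < j \<Longrightarrow> j \<le> n \<Longrightarrow> H i \<subset> H j" for i j
  proof (induction j)
    case (Suc j)
    then show ?case using step[of j] by (cases "i = j") auto
  qed simp
  have "inj_on H {..n}"
    by (rule linorder_inj_onI) (use less in auto)
  \<comment> \<open>A chief series of length \<open>n\<close> has \<open>Suc n\<close> distinct
    terms, which matches the \<open>Suc m\<close> of \<open>card_normal_chain_le\<close>.\<close>
  then have "card (H ` {..n}) = Suc n" by (simp add: card_image)
  moreover have "card (H ` {..n}) \<le> Suc m"
  proof (rule card_normal_chain_le[OF assms(1,3)])
    show "A \<lhd> G" if "A \<in> H ` {..n}" for A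
      using that assms(2) by (auto simp: chief_series_def)
    show "A \<subseteq> B \<or> B \<subseteq> A" if AB: "A \<in> H ` {..n}" "B \<in> H ` {..n}" for A B
    proof -
      obtain i j where "A = H i" "i \<le> n" "B = H j" "j \<le> n" using AB by auto
      then show ?thesis using less[of i j] less[of j i] by (cases i j rule: linorder_cases) auto
    qed
  qed simp
  ultimately show ?thesis by simp
qed

section \<open>Existence of chief series\<close>

definition chief_series_to :: "('a, 'b) monoid_scheme \<Rightarrow> 'a set \<Rightarrow> nat \<Rightarrow> (nat \<Rightarrow> 'a set) \<Rightarrow> bool" where
  "chief_series_to G N n H \<longleftrightarrow>
     H 0 = {\<one>\<^bsub>G\<^esub>} \<and> H n = N \<and> (\<forall>i\<le>n. H i \<lhd> G) \<and>
     (\<forall>i<n. H i \<subset> H (Suc i) \<and>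
        (\<forall>M. M \<lhd> G \<and> H i \<subseteq> M \<and> M \<subseteq> H (Suc i) \<longrightarrow> M = H i \<or> M = H (Suc i)))"

text \<open>The terms of a chief series are normal in all of \<open>G\<close>, so the induction
  cannot pass to a smaller group. Instead \<open>G\<close> stays fixed and the top \<open>N\<close>
  shrinks to a normal subgroup of \<open>G\<close> maximal among those properly inside
  \<open>N\<close>.\<close>

lemma (in group) chief_series_to_exists:
  assumes "finite (carrier G)" "N \<lhd> G"
  shows "\<exists>n H. chief_series_to G N n H"
  using assms(2)
proof (induction "card N" arbitrary: N rule: less_induct)
  case less
  show ?case
  proof (cases "N = {\<one>}")
    case True
    then have "chief_series_to G N 0 (\<lambda>_. N)" using less.prems by (simp add: chief_series_to_def)
    then show ?thesis by blast
  next
    case False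
    let ?X = "{M. M \<lhd> G \<and> M \<subset> N}"
    have finN: "finite N" using finite_subset[OF normal_imp_subset[OF less.prems] assms(1)] .
    have "{\<one>} \<in> ?X"
      using one_is_normal False subgroup.one_closed[OF normal_imp_subgroup[OF less.prems]] by blast
    moreover have "finite ?X" by (rule finite_subset[OF _ finite_normals[OF assms(1)]]) auto
    ultimately obtain M where M: "M \<in> ?X" "\<forall>L\<in>?X. M \<subseteq> L \<longrightarrow> M = L"
      using finite_has_maximal[of ?X] by blast
    then have "card M < card N" using psubset_card_mono[OF finN] by blast
    then obtain n H where "chief_series_to G M n H" using less.hyps[of M] M(1) by blast
    note H = this[unfolded chief_series_to_def]
    have "chief_series_to G N (Suc n) (H(Suc n := N))"
      unfolding chief_series_to_def
    proof (intro conjI allI impI)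
      fix i assume i: "i < Suc n"
      show "(H(Suc n := N)) i \<subset> (H(Suc n := N)) (Suc i)"
        using i H M(1) by (cases "i = n") auto
      fix L assume L: "L \<lhd> G \<and> (H(Suc n := N)) i \<subseteq> L \<and> L \<subseteq> (H(Suc n := N)) (Suc i)"
      show "L = (H(Suc n := N)) i \<or> L = (H(Suc n := N)) (Suc i)"
      proof (cases "i = n")
        case True
        then show ?thesis using L H M by auto
      next
        case False
        then show ?thesis using L H i by auto
      qed
    next
      fix i assume "i \<le> Suc n"
      then show "(H(Suc n := N)) i \<lhd> G" using H less.prems by (cases "i = Suc n") auto
    qed (use H in auto)
    then show ?thesis by blast
  qed
qed

lemma (in group) chief_series_exists:
  assumes "finite (carrier G)" shows "\<exists>n H. chief_series G n H"
  using chief_series_to_exists[OF assms carrier_normal] by (simp add: chief_series_to_def chief_series_def)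

theorem theorem5p12:
  fixes G :: "('a, 'b) monoid_scheme"
  assumes "group G" and "finite (carrier G)"
  shows "enat (mu G) = cx G \<and> cx G \<le> enat (socle_length G) \<and>
         socle_length G \<le> chief_length G \<and> chief_length G \<le> JH_length G"
proof -
  interpret group G by fact
  note fin = assms(2)
  \<comment> \<open>The lengths \<open>chief_length\<close> and \<open>JH_length\<close> are chosen
    by \<open>SOME\<close>; existence of the series makes each the length of an actual series.
    \<open>chief_le_composition\<close> compares any two such series, so it applies to these
    choices.\<close>
  obtain H where H: "chief_series G (chief_length G) H"
    using someI_ex[OF chief_series_exists[OF fin]] unfolding chief_length_def by blast
  obtain V where V: "composition_series G (JH_length G) V"
    using someI_ex[OF composition_series_exists[OF assms]] unfolding JH_length_def by blast
  \<comment> \<open>The top term of the chief series is \<open>G\<close>, so the socle series has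
    reached \<open>G\<close> at this index. This bounds \<open>socle_length\<close> and also shows
    that its minimum is attained.\<close>
  have "carrier G \<subseteq> socle_series G (chief_length G)"
    using chief_series_subset_socle_series[OF fin H order_refl] H by (simp add: chief_series_def)
  then have soc: "socle_series G (chief_length G) = carrier G"
    using normal_imp_subset[OF socle_series_normal[OF fin]] by blast
  then have "socle_length G \<le> chief_length G" unfolding socle_length_def by (rule Least_le)
  moreover have "mu G \<le> socle_length G"
  proof -
    have "socle_series G (socle_length G) = carrier G"
      unfolding socle_length_def using soc by (rule LeastI)
    then show ?thesis
      using mu_le socle_series_has_simples_series[OF fin, of "socle_length G"] by simp
  qed
  moreover have "chief_length G \<le> JH_length G" by (rule chief_le_composition[OF is_group H V])
  ultimately show ?thesis using cx_eq_mu[OF assms] by simp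
qed

end
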